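(* Let $(\Omega,d)$, $m$, $\mathcal R=\{R_\alpha:\alpha\in J\}$, $\beta$ be as in the context, let $l,u$ be lower and upper sequences, and suppose $m$ satisfies condition (M1) with respect to $l$ and $u$. Suppose that $(\mathcal R,\beta)$ is a global $m$-ubiquitous system relative to $(\rho,l,u)$ (with common dimension $\gamma$) and that $\psi$ is an approximating function. Assume that $$\limsup_{n\to\infty}\frac{\psi(u_n)}{\rho(u_n)}>0,$$ or assume that $$\sum_{n=1}^{\infty}\frac{m(B_n(\psi(u_n)))}{m(B_n(\rho(u_n)))}\left(\frac{\rho(u_n)}{\psi(u_n)}\right)^{\gamma}=\infty$$ and that there is a constant $K>0$ such that for all sufficiently large $Q$ $$\sum_{s=1}^{Q-1}\frac{\rho(u_s)^{\gamma}}{m(B_s(\rho(u_s)))}\sum_{\substack{s+1\le t\le Q:\\ \psi(u_s)<\rho(u_t)}}\frac{m(B_t(\psi(u_t)))}{\psi(u_t)^{\gamma}}\;\le\;K\left(\sum_{n=1}^{Q}\frac{m(B_n(\psi(u_n)))}{m(B_n(\rho(u_n)))}\left(\frac{\rho(u_n)}{\psi(u_n)}\right)^{\gamma}\right)^2.$$ Then $m(\Lambda(\psi))>0$. In addition, if every open subset of $\Omega$ is $m$-measurable and $(\mathcal R,\beta)$ is a local $m$-ubiquitous system relative to $(\rho,l,u)$, then $m(\Lambda(\psi))=1$.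
   Context: $(\Omega,d)$ is a compact metric space and $m$ a non-atomic probability measure on $\Omega$. A ball is $B(x,r)=\{y\in\Omega:d(x,y)<r\}$ (or its closed version) with $x\in\Omega$; $r(B)$ is its radius. Standing assumptions on $m$: $m(B(x,r))>0$ for all $x\in\Omega,r>0$, and $m$ is doubling: there is $C\ge1$ with $m(B(x,2r))\le C\,m(B(x,r))$ for all $x\in\Omega$, $r>0$. $J$ is an infinite countable index set, $\mathcal R=\{R_\alpha\subset\Omega:\alpha\in J\}$ a family of subsets ("resonant sets"), and $\beta:J\to\mathbb R^+$, $\alpha\mapsto\beta_\alpha$, is such that $\{\alpha:\beta_\alpha\le C\}$ is finite for every $C$. For $A\subset\Omega$, $\Delta(A,\delta)=\{x\in\Omega:\mathrm{dist}(x,A)<\delta\}$. An approximating function is a real, positive, decreasing $\psi:\mathbb R^+\to\mathbb R^+$, and $\Lambda(\psi)=\{x\in\Omega:x\in\Delta(R_\alpha,\psi(\beta_\alpha))\text{ for infinitely many }\alpha\in J\}$. Lower/upper sequences: $l=(l_n)$, $u=(u_n)$ positive increasing with $l_n<u_n$, $l_n\to\infty$; $J^u_l(n)=\{\alpha\in J:l_n<\beta_\alpha\le u_n\}$. A ubiquity function is $\rho:\mathbb R^+\to\mathbb R^+$ with $\rho(r)\to0$ as $r\to\infty$; $\Delta^u_l(\rho,n)=\bigcup_{\alpha\in J^u_l(n)}\Delta(R_\alpha,\rho(u_n))$. Condition (M1) w.r.t. $l,u$: there are $r_0>0$ and $a,b>0$ (independent of $n$ and of the balls) such that for all $n$, all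 $c\in R_\alpha$, $c'\in R_{\alpha'}$ with $\alpha,\alpha'\in J^u_l(n)$ and all $r<r_0$, $a\le m(B(c,r))/m(B(c',r))\le b$. $B_n(r)$ denotes a generic ball of radius $r$ centred at a point of some $R_\alpha$ with $\alpha\in J^u_l(n)$; by (M1) its measure is determined up to constants independent of $n$. Intersection conditions (relative to $(\rho,l,u)$): there are constants $\gamma$ with $0\le\gamma\le\dim\Omega$ (Hausdorff dimension) and $0<c_1<1<c_2$ such that for every $\alpha\in J$ with $\beta_\alpha\le u_n$, every $c\in R_\alpha$ and every $0<\lambda\le\rho(u_n)$, for $n$ sufficiently large: (i) $m(B(c,\tfrac12\rho(u_n))\cap\Delta(R_\alpha,\lambda))\ge c_1\,m(B(c,\lambda))(\rho(u_n)/\lambda)^{\gamma}$; (ii) $m(B\cap B(c,3\rho(u_n))\cap\Delta(R_\alpha,3\lambda))\le c_2\,m(B(c,\lambda))(r(B)/\lambda)^{\gamma}$ for every ball $B$ centred at a point of a resonant set with $r(B)\le3\rho(u_n)$. $\gamma$ is the common dimension. $(\mathcal R,\beta)$ is a local $m$-ubiquitous system relative to $(\rho,l,u)$ if the intersection conditions hold and there are $r_0,\kappa>0$ such that for every ball $B=B(x,r)$, $x\in\Omega$, $r\le r_0$: $m(B\cap\Delta^u_l(\rho,n))\ge\kappa\,m(B)$ for all $n\ge n_0(B)$. It is a global $m$-ubiquitous system relative to $(\rho,l,u)$ if the intersection conditions hold and there is $\kappa>0$ with $m(\Delta^u_l(\rho,n))\ge\kappa$ for all $n\ge n_0$. *)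

theory Defs
  imports "HOL-Probability.Probability"
begin

text \<open>
  The ambient compact metric space is the whole type, and the measure lives on \<^term>\<open>UNIV\<close> with an
  arbitrary sigma-algebra. The parameter \<open>B\<close> below is the ball convention,
  either \<^term>\<open>ball\<close> (open balls) or \<^term>\<open>cball\<close> (closed balls).
  Sequences are indexed by \<open>n \<ge> 1\<close>; their value at 0 is unconstrained and irrelevant.
\<close>

definition diameter_pow :: "real \<Rightarrow> 'a::metric_space set \<Rightarrow> ennreal" where
  \<comment> \<open>\<^term>\<open>0 powr 0 = (0::real)\<close>, so exponent 0 has to be treated separately for 0-dimensional
     Hausdorff measure to be counting measure.\<close>
  "diameter_pow s U = (if U = {} then 0 else if s = 0 then 1 else ennreal (diameter U powr s))"

definition hausdorff_premeasure :: "real \<Rightarrow> real \<Rightarrow> 'a::metric_space set \<Rightarrow> ennreal" where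
  "hausdorff_premeasure s \<delta> A =
     (INF U \<in> {U :: nat \<Rightarrow> 'a set. A \<subseteq> (\<Union>i. U i) \<and> (\<forall>i. bounded (U i) \<and> diameter (U i) \<le> \<delta>)}.
        \<Sum>i. diameter_pow s (U i))"

definition hausdorff_measure :: "real \<Rightarrow> 'a::metric_space set \<Rightarrow> ennreal" where
  "hausdorff_measure s A = (SUP \<delta>\<in>{0<..}. hausdorff_premeasure s \<delta> A)"

definition hausdorff_dim :: "'a::metric_space set \<Rightarrow> ereal" where
  "hausdorff_dim A = Inf {ereal s | s. 0 \<le> s \<and> hausdorff_measure s A = 0}"

definition non_atomic :: "'a measure \<Rightarrow> bool" where
  "non_atomic m \<longleftrightarrow>
     (\<forall>A\<in>sets m. 0 < emeasure m A \<longrightarrow>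
        (\<exists>A'\<in>sets m. A' \<subseteq> A \<and> 0 < emeasure m A' \<and> emeasure m A' < emeasure m A))"

definition doubling_measure :: "('a \<Rightarrow> real \<Rightarrow> 'a set) \<Rightarrow> 'a measure \<Rightarrow> bool" where
  "doubling_measure B m \<longleftrightarrow>
     (\<exists>C\<ge>1. \<forall>x. \<forall>r>0. measure m (B x (2 * r)) \<le> C * measure m (B x r))"

definition thickening :: "'a::metric_space set \<Rightarrow> real \<Rightarrow> 'a set" where
  \<comment> \<open>The distance to the empty set is infinite here, whereas \<^term>\<open>infdist x {} = 0\<close>.\<close>
  "thickening A \<delta> = {x. A \<noteq> {} \<and> infdist x A < \<delta>}"

definition approximating_function :: "(real \<Rightarrow> real) \<Rightarrow> bool" where
  "approximating_function \<psi> \<longleftrightarrow> (\<forall>r>0. 0 < \<psi> r) \<and> antimono_on {0<..} \<psi>"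

definition ubiquity_function :: "(real \<Rightarrow> real) \<Rightarrow> bool" where
  "ubiquity_function \<rho> \<longleftrightarrow> (\<forall>r>0. 0 < \<rho> r) \<and> (\<rho> \<longlongrightarrow> 0) at_top"

definition lower_upper_sequences :: "(nat \<Rightarrow> real) \<Rightarrow> (nat \<Rightarrow> real) \<Rightarrow> bool" where
  "lower_upper_sequences l u \<longleftrightarrow>
     (\<forall>n\<ge>1. 0 < l n \<and> l n < u n) \<and> mono_on {1..} l \<and> mono_on {1..} u \<and>
     filterlim l at_top sequentially"

definition limsup_set ::
  "'i set \<Rightarrow> ('i \<Rightarrow> 'a::metric_space set) \<Rightarrow> ('i \<Rightarrow> real) \<Rightarrow> (real \<Rightarrow> real) \<Rightarrow> 'a set" where
  "limsup_set J R \<beta> \<psi> = {x. infinite {\<alpha>\<in>J. x \<in> thickening (R \<alpha>) (\<psi> (\<beta> \<alpha>))}}"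

definition index_block ::
  "'i set \<Rightarrow> ('i \<Rightarrow> real) \<Rightarrow> (nat \<Rightarrow> real) \<Rightarrow> (nat \<Rightarrow> real) \<Rightarrow> nat \<Rightarrow> 'i set" where
  "index_block J \<beta> l u n = {\<alpha>\<in>J. l n < \<beta> \<alpha> \<and> \<beta> \<alpha> \<le> u n}"

definition thickened_block ::
  "'i set \<Rightarrow> ('i \<Rightarrow> 'a::metric_space set) \<Rightarrow> ('i \<Rightarrow> real) \<Rightarrow> (nat \<Rightarrow> real) \<Rightarrow> (nat \<Rightarrow> real)
     \<Rightarrow> (real \<Rightarrow> real) \<Rightarrow> nat \<Rightarrow> 'a set" where
  "thickened_block J R \<beta> l u \<rho> n = (\<Union>\<alpha>\<in>index_block J \<beta> l u n. thickening (R \<alpha>) (\<rho> (u n)))"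

definition condition_M1 ::
  "('a \<Rightarrow> real \<Rightarrow> 'a set) \<Rightarrow> 'a measure \<Rightarrow> 'i set \<Rightarrow> ('i \<Rightarrow> 'a set) \<Rightarrow> ('i \<Rightarrow> real)
     \<Rightarrow> (nat \<Rightarrow> real) \<Rightarrow> (nat \<Rightarrow> real) \<Rightarrow> bool" where
  "condition_M1 B m J R \<beta> l u \<longleftrightarrow>
     (\<exists>r0>0. \<exists>a>0. \<exists>b>0. \<forall>n\<ge>1.
        \<forall>\<alpha>\<in>index_block J \<beta> l u n. \<forall>\<alpha>'\<in>index_block J \<beta> l u n. \<forall>c\<in>R \<alpha>. \<forall>c'\<in>R \<alpha>'. \<forall>r.
          0 < r \<and> r < r0 \<longrightarrow>
            a \<le> measure m (B c r) / measure m (B c' r) \<and>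
            measure m (B c r) / measure m (B c' r) \<le> b)"

definition generic_balls ::
  "('a \<Rightarrow> real \<Rightarrow> 'a set) \<Rightarrow> 'i set \<Rightarrow> ('i \<Rightarrow> 'a set) \<Rightarrow> ('i \<Rightarrow> real)
     \<Rightarrow> (nat \<Rightarrow> real) \<Rightarrow> (nat \<Rightarrow> real) \<Rightarrow> (nat \<Rightarrow> real \<Rightarrow> 'a set) \<Rightarrow> bool" where
  \<comment> \<open>If the \<open>n\<close>-th block has no resonant point (under ubiquity this happens for at most finitely
     many \<open>n\<close>), the centre is unconstrained.\<close>
  "generic_balls B J R \<beta> l u Bn \<longleftrightarrow>
     (\<forall>n\<ge>1. \<forall>r>0. \<exists>c. Bn n r = B c r \<and>
        ((\<Union>\<alpha>\<in>index_block J \<beta> l u n. R \<alpha>) \<noteq> {} \<longrightarrow> c \<in> (\<Union>\<alpha>\<in>index_block J \<beta> l u n. R \<alpha>)))"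

definition intersection_conditions ::
  "('a::metric_space \<Rightarrow> real \<Rightarrow> 'a set) \<Rightarrow> 'a measure \<Rightarrow> 'i set \<Rightarrow> ('i \<Rightarrow> 'a set) \<Rightarrow> ('i \<Rightarrow> real)
     \<Rightarrow> (nat \<Rightarrow> real) \<Rightarrow> (real \<Rightarrow> real) \<Rightarrow> real \<Rightarrow> bool" where
  \<comment> \<open>\<open>B x r\<close> is the arbitrary ball centred at a point of a resonant set in the second condition.\<close>
  "intersection_conditions B m J R \<beta> u \<rho> \<gamma> \<longleftrightarrow>
     0 \<le> \<gamma> \<and> ereal \<gamma> \<le> hausdorff_dim (UNIV :: 'a set) \<and>
     (\<exists>c1 c2. 0 < c1 \<and> c1 < 1 \<and> 1 < c2 \<and>
        (\<exists>N\<ge>1. \<forall>n\<ge>N. \<forall>\<alpha>\<in>J. \<forall>c\<in>R \<alpha>. \<forall>t. \<beta> \<alpha> \<le> u n \<and> 0 < t \<and> t \<le> \<rho> (u n) \<longrightarrow>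
           c1 * measure m (B c t) * (\<rho> (u n) / t) powr \<gamma>
             \<le> measure m (B c (\<rho> (u n) / 2) \<inter> thickening (R \<alpha>) t) \<and>
           (\<forall>\<alpha>'\<in>J. \<forall>x\<in>R \<alpha>'. \<forall>r. 0 < r \<and> r \<le> 3 * \<rho> (u n) \<longrightarrow>
              measure m (B x r \<inter> B c (3 * \<rho> (u n)) \<inter> thickening (R \<alpha>) (3 * t))
                \<le> c2 * measure m (B c t) * (r / t) powr \<gamma>)))"

definition local_ubiquitous ::
  "('a::metric_space \<Rightarrow> real \<Rightarrow> 'a set) \<Rightarrow> 'a measure \<Rightarrow> 'i set \<Rightarrow> ('i \<Rightarrow> 'a set) \<Rightarrow> ('i \<Rightarrow> real)
     \<Rightarrow> (nat \<Rightarrow> real) \<Rightarrow> (nat \<Rightarrow> real) \<Rightarrow> (real \<Rightarrow> real) \<Rightarrow> real \<Rightarrow> bool" where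
  "local_ubiquitous B m J R \<beta> l u \<rho> \<gamma> \<longleftrightarrow>
     intersection_conditions B m J R \<beta> u \<rho> \<gamma> \<and>
     (\<exists>r0>0. \<exists>\<kappa>>0. \<forall>x. \<forall>r. 0 < r \<and> r \<le> r0 \<longrightarrow>
        (\<exists>n0\<ge>1. \<forall>n\<ge>n0.
           measure m (B x r \<inter> thickened_block J R \<beta> l u \<rho> n) \<ge> \<kappa> * measure m (B x r)))"

definition global_ubiquitous ::
  "('a::metric_space \<Rightarrow> real \<Rightarrow> 'a set) \<Rightarrow> 'a measure \<Rightarrow> 'i set \<Rightarrow> ('i \<Rightarrow> 'a set) \<Rightarrow> ('i \<Rightarrow> real)
     \<Rightarrow> (nat \<Rightarrow> real) \<Rightarrow> (nat \<Rightarrow> real) \<Rightarrow> (real \<Rightarrow> real) \<Rightarrow> real \<Rightarrow> bool" where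
  "global_ubiquitous B m J R \<beta> l u \<rho> \<gamma> \<longleftrightarrow>
     intersection_conditions B m J R \<beta> u \<rho> \<gamma> \<and>
     (\<exists>\<kappa>>0. \<exists>n0\<ge>1. \<forall>n\<ge>n0. measure m (thickened_block J R \<beta> l u \<rho> n) \<ge> \<kappa>)"

end

theory Submission
  imports Defs
begin

text \<open>
  Around a set \<open>V\<close> that the \<open>n\<close>-th block covers in positive proportion, take a maximal
  \<open>2 \<rho>(u\<^sub>n)\<close>-separated set of resonant points \<open>c\<close> and let \<open>A\<^sub>n\<close> be the union of the pieces
  \<open>B(c, \<rho>(u\<^sub>n)/2) \<inter> \<Delta>(R\<^sub>\<alpha>, \<psi>(u\<^sub>n))\<close>. The intersection conditions give the measure of \<open>A\<^sub>n\<close> up to constants and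
  bound \<open>m(A\<^sub>s \<inter> A\<^sub>t)\<close> by the product of the two measures when \<open>\<rho>(u\<^sub>t) \<le> \<psi>(u\<^sub>s)\<close>, and otherwise by the
  \<open>(s, t)\<close> summand of the second hypothesis. The Chung--Erdos inequality then yields
  \<open>m(W \<inter> limsup A\<^sub>n) \<ge> c m(W)\<close> for every \<open>W\<close> containing a neighbourhood of \<open>V\<close>, with \<open>c\<close> independent of
  \<open>W\<close>; if \<open>\<psi>(u\<^sub>n) \<ge> \<eta> \<rho>(u\<^sub>n)\<close> infinitely often, disjoint balls of radius comparable to \<open>\<rho>(u\<^sub>n)\<close> already
  do this. In the global case take \<open>V = W = \<Omega>\<close>. In the local case a closed set
  of positive measure missed by the limsup set would contradict the bound on small neighbourhoods.
\<close>

subsection \<open>Nets, second moments and doubling balls\<close>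

lemma thickening_iff: "x \<in> thickening A \<delta> \<longleftrightarrow> (\<exists>a\<in>A. dist x a < \<delta>)"
proof (cases "A = {}")
  case False
  have "infdist x A < \<delta> \<longleftrightarrow> (\<exists>a\<in>A. dist x a < \<delta>)"
    unfolding infdist_notempty[OF False]
    by (rule cINF_less_iff) (use False in \<open>auto intro: bdd_belowI[of _ 0]\<close>)
  then show ?thesis
    using False by (simp add: thickening_def)
qed (simp add: thickening_def)

lemma open_thickening: "open (thickening A \<delta>)"
proof -
  have "thickening A \<delta> = (\<Union>a\<in>A. ball a \<delta>)"
    by (auto simp: thickening_iff dist_commute)
  then show ?thesis by auto
qed

text \<open>Each ball of radius \<open>r/2\<close> in a finite cover of the space contains at most
  one point of an \<open>r\<close>-separated set. This bounds the cardinalities, so a separated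
  subset of greatest cardinality exists, and an uncovered point of \<open>A\<close> could be added
  to it.\<close>

lemma separated_net:
  fixes A :: "'a::metric_space set"
  assumes "compact (UNIV :: 'a set)" and "0 < r"
  obtains G where "finite G" "G \<subseteq> A" "pairwise (\<lambda>x y. r \<le> dist x y) G"
    "A \<subseteq> (\<Union>x\<in>G. ball x r)"
proof -
  define sep where "sep G \<longleftrightarrow> G \<subseteq> A \<and> pairwise (\<lambda>x y. r \<le> dist x y) G" for G
  obtain K :: "'a set" where K: "finite K" "UNIV \<subseteq> (\<Union>k\<in>K. ball k (r/2))"
    using compactE_image[of UNIV UNIV "\<lambda>k::'a. ball k (r/2)"] assms
    by (metis UNIV_I UN_I centre_in_ball half_gt_zero open_ball subsetI)
  have sep: "finite G \<and> card G \<le> card K" if "sep G" for G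
  proof -
    have "\<forall>x. \<exists>k\<in>K. dist k x < r/2"
      using K(2) by (auto simp: subset_iff)
    then obtain f where f: "f x \<in> K" "dist (f x) x < r/2" for x
      by metis
    have "inj_on f G"
    proof (rule inj_onI, rule ccontr)
      fix x y assume xy: "x \<in> G" "y \<in> G" "f x = f y" "x \<noteq> y"
      have "dist x y \<le> dist (f x) x + dist (f x) y" by (rule dist_triangle3)
      also have "\<dots> < r" using f(2)[of x] f(2)[of y] xy(3) by simp
      finally show False using xy that by (force simp: sep_def pairwise_def)
    qed
    moreover have "f ` G \<subseteq> K" using f by auto
    ultimately show ?thesis
      using K(1) by (meson card_inj_on_le inj_on_finite)
  qed
  have "sep {}" by (simp add: sep_def)
  then obtain G where G: "sep G" and max: "\<And>H. sep H \<Longrightarrow> card H \<le> card G"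
    using ex_has_greatest_nat[of sep "{}" card "Suc (card K)"] sep by (auto simp: less_Suc_eq_le)
  have "A \<subseteq> (\<Union>x\<in>G. ball x r)"
  proof (rule subsetI, rule ccontr)
    fix a assume a: "a \<in> A" "a \<notin> (\<Union>x\<in>G. ball x r)"
    then have "sep (insert a G)"
      using G by (auto simp: sep_def pairwise_insert dist_commute)
    moreover have "a \<notin> G" using a assms by auto
    ultimately show False
      using max[of "insert a G"] sep[OF G] by simp
  qed
  moreover have "G \<subseteq> A" "pairwise (\<lambda>x y. r \<le> dist x y) G"
    using G by (auto simp: sep_def)
  ultimately show ?thesis
    using that[of G] sep[OF G] by simp
qed

context finite_measure
begin

text \<open>With f the sum of the indicators, the integral of the square of f - \<theta>
  \<open>indicator U\<close> is a nonnegative quadratic polynomial in \<theta>. Its value at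
  \<open>S / measure M U\<close> gives the inequality.\<close>

lemma chung_erdos:
  assumes "finite I" and A: "\<And>i. i \<in> I \<Longrightarrow> A i \<in> sets M"
  shows "(\<Sum>i\<in>I. measure M (A i))\<^sup>2
           \<le> measure M (\<Union>i\<in>I. A i) * (\<Sum>i\<in>I. \<Sum>j\<in>I. measure M (A i \<inter> A j))"
proof -
  define U where "U = (\<Union>i\<in>I. A i)"
  define S where "S = (\<Sum>i\<in>I. measure M (A i))"
  define T where "T = (\<Sum>i\<in>I. \<Sum>j\<in>I. measure M (A i \<inter> A j))"
  have U: "U \<in> sets M" unfolding U_def using assms by auto
  have pos: "0 \<le> T - 2 * \<theta> * S + \<theta>\<^sup>2 * measure M U" for \<theta>
  proof -
    define g where "g x = (\<Sum>i\<in>I. \<Sum>j\<in>I. indicator (A i \<inter> A j) x)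
        - 2 * \<theta> * (\<Sum>i\<in>I. indicator (A i) x) + \<theta>\<^sup>2 * indicator U x" for x :: 'a
    have "g x = ((\<Sum>i\<in>I. indicator (A i) x) - \<theta> * indicator U x)\<^sup>2" for x
    proof -
      have "(\<Sum>i\<in>I. indicator (A i) x) * indicator U x = (\<Sum>i\<in>I. indicator (A i) x :: real)"
        unfolding sum_distrib_right by (rule sum.cong) (auto simp: U_def indicator_def)
      moreover have "(indicator U x)\<^sup>2 = (indicator U x :: real)"
        by (simp add: indicator_def)
      moreover have "(\<Sum>i\<in>I. \<Sum>j\<in>I. indicator (A i \<inter> A j) x :: real) = (\<Sum>i\<in>I. indicator (A i) x)\<^sup>2"
        by (simp add: power2_eq_square sum_product indicator_inter_arith)
      ultimately show ?thesis
        unfolding g_def power2_diff power_mult_distrib by (simp add: algebra_simps)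
    qed
    then have "0 \<le> integral\<^sup>L M g" by simp
    also have "integral\<^sup>L M g = T - 2 * \<theta> * S + \<theta>\<^sup>2 * measure M U"
    proof -
      have int: "integrable M (indicator X :: _ \<Rightarrow> real)" "(LINT x|M. indicator X x) = measure M X"
        if "X \<in> sets M" for X
        using that by (auto simp: emeasure_eq_measure)
      show ?thesis
        unfolding g_def T_def S_def
        using A U by (simp add: int)
    qed
    finally show ?thesis .
  qed
  have "S\<^sup>2 \<le> measure M U * T"
  proof (cases "measure M U = 0")
    case True
    have "measure M (A i) = 0" if "i \<in> I" for i
    proof (rule antisym)
      show "measure M (A i) \<le> 0"
        using finite_measure_mono[of "A i" U] that U True by (auto simp: U_def)
    qed simp
    then show ?thesis using True by (simp add: S_def)
  next
    case False
    then have "0 < measure M U" by (simp add: zero_less_measure_iff)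
    then show ?thesis
      using pos[of "S / measure M U"] by (simp add: field_simps power2_eq_square)
  qed
  then show ?thesis by (simp add: S_def T_def U_def)
qed

lemma measure_limsup_ge:
  fixes E :: "nat \<Rightarrow> 'a set"
  assumes "\<And>n. E n \<in> sets M" and "W \<in> sets M"
    and "\<And>N. N \<ge> N0 \<Longrightarrow> c \<le> measure M (W \<inter> (\<Union>n\<in>{N..}. E n))"
  shows "c \<le> measure M (W \<inter> (\<Inter>N. \<Union>n\<in>{N..}. E n))"
proof -
  define F where "F N = W \<inter> (\<Union>n\<in>{N..}. E n)" for N
  have "F N \<in> sets M" for N
    unfolding F_def using assms by (intro sets.Int sets.countable_UN') auto
  moreover have "decseq F" unfolding decseq_def F_def by fastforce
  ultimately have "(\<lambda>N. measure M (F N)) \<longlonglongrightarrow> measure M (\<Inter>N. F N)"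
    by (intro finite_Lim_measure_decseq) auto
  moreover have "(\<Inter>N. F N) = W \<inter> (\<Inter>N. \<Union>n\<in>{N..}. E n)" by (auto simp: F_def)
  ultimately show ?thesis
    using assms(3) by (metis LIMSEQ_le_const F_def)
qed

end

locale doubling_balls = prob_space m
  for m :: "'a::metric_space measure" +
  fixes B :: "'a \<Rightarrow> real \<Rightarrow> 'a set" and C :: real
  assumes compact_UNIV: "compact (UNIV :: 'a set)"
    and B_cases: "B = ball \<or> B = cball"
    and space_UNIV: "space m = UNIV"
    and B_sets: "\<And>x r. 0 < r \<Longrightarrow> B x r \<in> sets m"
    and B_pos: "\<And>x r. 0 < r \<Longrightarrow> 0 < prob (B x r)"
    and C_ge1: "1 \<le> C"
    and doubling: "\<And>x r. 0 < r \<Longrightarrow> prob (B x (2 * r)) \<le> C * prob (B x r)"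
begin

lemma ball_subset_B: "ball x r \<subseteq> B x r" and B_subset_cball: "B x r \<subseteq> cball x r"
  using B_cases by auto

lemma dist_le_of_B: "y \<in> B x r \<Longrightarrow> dist x y \<le> r"
  using B_subset_cball[of x r] by auto

lemma in_B_of_dist: "dist x y < r \<Longrightarrow> y \<in> B x r"
  using ball_subset_B[of x r] by auto

lemma doubling_power: "0 < r \<Longrightarrow> prob (B x (2 ^ k * r)) \<le> C ^ k * prob (B x r)"
proof (induction k)
  case (Suc k)
  have "prob (B x (2 ^ Suc k * r)) \<le> C * prob (B x (2 ^ k * r))"
    using doubling[of "2 ^ k * r" x] Suc.prems by (simp add: mult.assoc)
  also have "\<dots> \<le> C * (C ^ k * prob (B x r))"
    using Suc C_ge1 by (intro mult_left_mono) auto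
  finally show ?case by (simp add: mult.assoc)
qed simp

text \<open>The sigma-algebra is only assumed to contain the balls \<open>B x r\<close>. For each
  \<open>n\<close>, finitely many of radius \<open>1 / Suc n\<close> cover the space, and an open
  set is the union of those among these countably many balls that it contains.\<close>

lemma open_sets:
  assumes "open U"
  shows "U \<in> sets m"
proof -
  have "\<exists>K::'a set. finite K \<and> UNIV \<subseteq> (\<Union>k\<in>K. ball k (1 / Suc n))" for n
    using separated_net[OF compact_UNIV, of "1 / Suc n" UNIV]
    by (metis of_nat_0_less_iff zero_less_Suc zero_less_divide_1_iff)
  then obtain K :: "nat \<Rightarrow> 'a set"
    where K: "finite (K n)" "UNIV \<subseteq> (\<Union>k\<in>K n. ball k (1 / Suc n))" for n
    by metis
  define I where "I = (SIGMA n:UNIV. {k\<in>K n. B k (1 / Suc n) \<subseteq> U})"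
  have "U = (\<Union>(n, k)\<in>I. B k (1 / Suc n))"
  proof
    show "U \<subseteq> (\<Union>(n, k)\<in>I. B k (1 / Suc n))"
    proof
      fix x assume "x \<in> U"
      then obtain e where e: "0 < e" "ball x e \<subseteq> U"
        using assms openE by blast
      obtain n where n: "1 / Suc n < e / 2"
        using e(1) by (meson half_gt_zero nat_approx_posE)
      obtain k where k: "k \<in> K n" "dist k x < 1 / Suc n"
        using K(2)[of n] by (auto dest: subsetD[OF _ UNIV_I[of x]])
      have "B k (1 / Suc n) \<subseteq> ball x e"
      proof
        fix y assume "y \<in> B k (1 / Suc n)"
        then have "dist k y \<le> 1 / Suc n" by (rule dist_le_of_B)
        then show "y \<in> ball x e"
          using k(2) n dist_triangle3[of x y k] by simp
      qed
      with e k show "x \<in> (\<Union>(n, k)\<in>I. B k (1 / Suc n))"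
        using in_B_of_dist[OF k(2)] by (auto simp: I_def)
    qed
  qed (auto simp: I_def)
  moreover have "countable I"
    unfolding I_def using K(1) by (intro countable_SIGMA) (auto intro: countable_finite)
  moreover have "B k (1 / Suc n) \<in> sets m" for k n
    by (rule B_sets) simp
  ultimately show ?thesis
    unfolding case_prod_beta by (metis (no_types, lifting) sets.countable_UN'')
qed

end

subsection \<open>Local lower bounds for the limsup set\<close>

text \<open>\<open>X n\<close> is the set of resonant points of the \<open>n\<close>-th block, \<open>D n c\<close> a resonant set of that block
  through \<open>c\<close>, and \<open>rh n\<close>, \<open>ps n\<close> stand for \<open>\<rho>(u\<^sub>n)\<close>, \<open>\<psi>(u\<^sub>n)\<close>.\<close>

locale resonant_blocks = doubling_balls m B C
  for m :: "'a::metric_space measure" and B C +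
  fixes X :: "nat \<Rightarrow> 'a set" and D :: "nat \<Rightarrow> 'a \<Rightarrow> 'a set" and rh ps :: "nat \<Rightarrow> real"
  assumes D_mem: "\<And>n c. c \<in> X n \<Longrightarrow> c \<in> D n c"
    and D_subset: "\<And>n c. c \<in> X n \<Longrightarrow> D n c \<subseteq> X n"
    and rh_pos: "\<And>n. 1 \<le> n \<Longrightarrow> 0 < rh n"
    and ps_pos: "\<And>n. 1 \<le> n \<Longrightarrow> 0 < ps n"
    and rh_lim: "rh \<longlonglongrightarrow> 0"
begin

text \<open>One radius \<open>ps n\<close> serves the whole block. Since \<psi> is decreasing, it is
  at most the radius that \<psi> assigns to each single resonant set of the block.\<close>

definition level :: "nat \<Rightarrow> 'a set" where
  "level n = (\<Union>c\<in>X n. thickening (D n c) (ps n))"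

definition limsup_level :: "'a set" where
  "limsup_level = (\<Inter>N. \<Union>n\<in>{N..}. level n)"

text \<open>The margin \<delta> between \<open>V\<close> and the complement of \<open>W\<close>
  keeps balls around resonant points near \<open>V\<close> inside \<open>W\<close> once
  \<open>rh n\<close> is small. The constant \<open>c\<close> may depend on \<kappa> but not on
  \<open>V\<close>, \<open>W\<close> or \<delta>; the passage to full measure rests on this
  uniformity.\<close>

definition density_bound :: "real \<Rightarrow> real \<Rightarrow> bool" where
  "density_bound \<kappa> c \<longleftrightarrow>
     (\<forall>V W \<delta>. W \<in> sets m \<longrightarrow> 0 < \<delta> \<longrightarrow> (\<forall>v\<in>V. ball v \<delta> \<subseteq> W) \<longrightarrow>
        (\<forall>\<^sub>F n in sequentially. \<kappa> * prob W \<le> prob (V \<inter> thickening (X n) (rh n))) \<longrightarrow>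
        c * prob W \<le> prob (W \<inter> limsup_level))"

lemma open_level: "open (level n)"
  by (auto simp: level_def open_thickening)

lemma level_sets: "level n \<in> sets m"
  by (rule open_sets[OF open_level])

text \<open>By continuity from above it suffices to bound the tail unions; the threshold
  \<open>N0\<close> may depend on \<open>V\<close>, \<open>W\<close> and \<delta>.\<close>

lemma density_boundI:
  assumes "\<And>V W \<delta>. W \<in> sets m \<Longrightarrow> 0 < \<delta> \<Longrightarrow> (\<And>v. v \<in> V \<Longrightarrow> ball v \<delta> \<subseteq> W) \<Longrightarrow>
      (\<forall>\<^sub>F n in sequentially. \<kappa> * prob W \<le> prob (V \<inter> thickening (X n) (rh n))) \<Longrightarrow>
      \<exists>N0. \<forall>N\<ge>N0. c * prob W \<le> prob (W \<inter> (\<Union>n\<in>{N..}. level n))"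
  shows "density_bound \<kappa> c"
  unfolding density_bound_def limsup_level_def
proof (intro allI impI)
  fix V W :: "'a set" and \<delta> :: real
  assume "W \<in> sets m" "0 < \<delta>" "\<forall>v\<in>V. ball v \<delta> \<subseteq> W"
      "\<forall>\<^sub>F n in sequentially. \<kappa> * prob W \<le> prob (V \<inter> thickening (X n) (rh n))"
  moreover from this obtain N0 where "\<forall>N\<ge>N0. c * prob W \<le> prob (W \<inter> (\<Union>n\<in>{N..}. level n))"
    using assms[of W \<delta> V] by auto
  ultimately show "c * prob W \<le> prob (W \<inter> (\<Inter>N. \<Union>n\<in>{N..}. level n))"
    using level_sets by (intro measure_limsup_ge[where ?N0.0 = N0]) auto
qed

text \<open>The net is taken among the resonant points within \<open>rh n\<close> of
  \<open>V\<close>. A point of \<open>V\<close> within \<open>rh n\<close> of such a point lies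
  within \<open>3 * rh n\<close> of the net; the radius is rounded up to \<open>4 * rh n\<close>,
  which two doublings reach from \<open>rh n\<close>.\<close>

lemma block_net:
  assumes V: "\<And>v. v \<in> V \<Longrightarrow> ball v \<delta> \<subseteq> W" and n: "1 \<le> n" "2 * rh n < \<delta>"
    and meas: "t \<le> prob (V \<inter> thickening (X n) (rh n))"
  obtains G where "finite G" "G \<subseteq> X n" "pairwise (\<lambda>x y. 2 * rh n \<le> dist x y) G"
    "\<forall>g\<in>G. cball g (rh n) \<subseteq> W" "t \<le> (\<Sum>g\<in>G. prob (B g (4 * rh n)))"
proof -
  have rh: "0 < rh n" using rh_pos n by simp
  then have "0 < 2 * rh n" by simp
  then obtain G where G: "finite G" "G \<subseteq> X n \<inter> thickening V (rh n)"
      "pairwise (\<lambda>x y. 2 * rh n \<le> dist x y) G"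
      "X n \<inter> thickening V (rh n) \<subseteq> (\<Union>x\<in>G. ball x (2 * rh n))"
    by (rule separated_net[OF compact_UNIV, where A = "X n \<inter> thickening V (rh n)"])
  have "cball g (rh n) \<subseteq> W" if g: "g \<in> G" for g
  proof -
    obtain v where v: "v \<in> V" "dist g v < rh n"
      using subsetD[OF G(2) g] by (auto simp: thickening_iff)
    have "cball g (rh n) \<subseteq> ball v \<delta>"
    proof
      fix y assume "y \<in> cball g (rh n)"
      then show "y \<in> ball v \<delta>"
        using v(2) n(2) dist_triangle3[of v y g] by (simp add: dist_commute)
    qed
    then show ?thesis using V[OF v(1)] by blast
  qed
  moreover have "t \<le> (\<Sum>g\<in>G. prob (B g (4 * rh n)))"
  proof -
    have "V \<inter> thickening (X n) (rh n) \<subseteq> (\<Union>g\<in>G. B g (4 * rh n))"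
    proof
      fix v assume "v \<in> V \<inter> thickening (X n) (rh n)"
      then obtain c where c: "v \<in> V" "c \<in> X n" "dist v c < rh n"
        by (auto simp: thickening_iff)
      then have "c \<in> X n \<inter> thickening V (rh n)"
        by (auto simp: thickening_iff dist_commute)
      then obtain g where g: "g \<in> G" "dist g c < 2 * rh n"
        using G(4) by auto
      then have "dist g v < 4 * rh n"
        using dist_triangle[of g v c] c(3) rh by (simp add: dist_commute)
      then show "v \<in> (\<Union>g\<in>G. B g (4 * rh n))"
        using g(1) in_B_of_dist by blast
    qed
    then have "prob (V \<inter> thickening (X n) (rh n)) \<le> prob (\<Union>g\<in>G. B g (4 * rh n))"
      using G(1) rh B_sets by (intro finite_measure_mono) auto
    also have "\<dots> \<le> (\<Sum>g\<in>G. prob (B g (4 * rh n)))"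
      using G(1) rh B_sets by (intro finite_measure_subadditive_finite) auto
    finally show ?thesis using meas by simp
  qed
  moreover have "G \<subseteq> X n" using G(2) by blast
  ultimately show ?thesis using that[OF G(1) _ G(3)] by blast
qed

lemma half_balls_disjoint:
  assumes "1 \<le> n" "pairwise (\<lambda>x y. 2 * rh n \<le> dist x y) G"
  shows "disjoint_family_on (\<lambda>g. B g (rh n / 2)) G"
  unfolding disjoint_family_on_def
proof (intro ballI impI, rule ccontr)
  fix x y assume xy: "x \<in> G" "y \<in> G" "x \<noteq> y" "B x (rh n / 2) \<inter> B y (rh n / 2) \<noteq> {}"
  then obtain z where z: "z \<in> B x (rh n / 2)" "z \<in> B y (rh n / 2)" by auto
  have "dist x y \<le> rh n"
    using dist_triangle2[of x y z] dist_le_of_B[OF z(1)] dist_le_of_B[OF z(2)] by simp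
  then show False using pairwiseD[OF assms(2) xy(1-3)] rh_pos[OF assms(1)] by simp
qed

lemma eventually_level_density:
  assumes "0 < \<delta>" "\<forall>\<^sub>F n in sequentially. t \<le> prob (V \<inter> thickening (X n) (rh n))"
  obtains N0 where "1 \<le> N0"
    "\<And>n. N0 \<le> n \<Longrightarrow> 2 * rh n < \<delta> \<and> t \<le> prob (V \<inter> thickening (X n) (rh n))"
proof -
  have "\<forall>\<^sub>F n in sequentially. rh n < \<delta> / 2"
    using rh_lim assms(1) by (intro order_tendstoD(2)) auto
  with assms(2) have "\<forall>\<^sub>F n in sequentially. 2 * rh n < \<delta> \<and> t \<le> prob (V \<inter> thickening (X n) (rh n))"
    by eventually_elim auto
  then obtain N where "\<forall>n\<ge>N. 2 * rh n < \<delta> \<and> t \<le> prob (V \<inter> thickening (X n) (rh n))"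
    by (auto simp: eventually_sequentially)
  then show ?thesis using that[of "max 1 N"] by auto
qed

text \<open>For a single \<open>n\<close> with \<open>\<eta> * rh n \<le> ps n\<close>, the level
  contains disjoint balls of radius comparable to \<open>rh n\<close>. By doubling they carry a
  fixed share of the measure of the covering balls, and such \<open>n\<close> exist beyond every
  \<open>N\<close>.\<close>

lemma density_bound_of_frequently:
  assumes "0 < \<eta>" and freq: "\<exists>\<^sub>F n in sequentially. \<eta> * rh n \<le> ps n" and "0 < \<kappa>"
  shows "\<exists>c>0. density_bound \<kappa> c"
proof -
  \<comment> \<open>The bound \<open>1/2\<close> puts the balls \<open>B g (\<theta> * rh n)\<close>
    inside the disjoint half balls, and \<open>\<theta> < \<eta>\<close> keeps even closed balls
    strictly within distance \<open>ps n\<close> of their centre.\<close>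
  define \<theta> where "\<theta> = min 1 \<eta> / 2"
  have \<theta>: "0 < \<theta>" "\<theta> \<le> 1/2" "\<theta> < \<eta>" using assms by (auto simp: \<theta>_def)
  \<comment> \<open>After \<open>k\<close> doublings the radius \<open>\<theta> * rh n\<close>
    exceeds the covering radius \<open>4 * rh n\<close>.\<close>
  obtain k :: nat where k: "4 / \<theta> < 2 ^ k"
    using real_arch_pow[of 2 "4 / \<theta>"] by auto
  have "density_bound \<kappa> (\<kappa> / C ^ k)"
  proof (rule density_boundI)
    fix V W :: "'a set" and \<delta> :: real
    assume W: "W \<in> sets m" and \<delta>: "0 < \<delta>" and V: "\<And>v. v \<in> V \<Longrightarrow> ball v \<delta> \<subseteq> W"
      and ev: "\<forall>\<^sub>F n in sequentially. \<kappa> * prob W \<le> prob (V \<inter> thickening (X n) (rh n))"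
    obtain N0 where N0: "1 \<le> N0"
      "\<And>n. N0 \<le> n \<Longrightarrow> 2 * rh n < \<delta> \<and> \<kappa> * prob W \<le> prob (V \<inter> thickening (X n) (rh n))"
      using eventually_level_density[OF \<delta> ev] by blast
    have "\<kappa> / C ^ k * prob W \<le> prob (W \<inter> (\<Union>n\<in>{N..}. level n))" if N: "N \<ge> N0" for N
    proof -
      obtain n where n: "n \<ge> N" "\<eta> * rh n \<le> ps n"
        using freq[unfolded frequently_sequentially] by blast
      then have n1: "1 \<le> n" using that N0 by simp
      then have rh: "0 < rh n" using rh_pos by simp
      obtain G where G: "finite G" "G \<subseteq> X n"
        "pairwise (\<lambda>x y. 2 * rh n \<le> dist x y) G"
        "\<forall>g\<in>G. cball g (rh n) \<subseteq> W" "\<kappa> * prob W \<le> (\<Sum>g\<in>G. prob (B g (4 * rh n)))"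
        using N0(2)[of n] n(1) N by (auto intro: block_net[OF V n1])
      have sub: "B g (\<theta> * rh n) \<subseteq> B g (rh n / 2)" for g
      proof -
        have "\<theta> * rh n \<le> rh n / 2" using \<theta> rh by (simp add: mult_right_mono)
        then show ?thesis using B_cases by auto
      qed
      have "disjoint_family_on (\<lambda>g. B g (\<theta> * rh n)) G"
        using half_balls_disjoint[OF n1 G(3)] sub unfolding disjoint_family_on_def by blast
      then have "(\<Sum>g\<in>G. prob (B g (\<theta> * rh n))) = prob (\<Union>g\<in>G. B g (\<theta> * rh n))"
        using G(1) B_sets \<theta> rh by (intro finite_measure_finite_Union[symmetric]) auto
      also have "\<dots> \<le> prob (W \<inter> (\<Union>n\<in>{N..}. level n))"
      proof (rule finite_measure_mono)
        have "B g (\<theta> * rh n) \<subseteq> W \<inter> level n" if g: "g \<in> G" for g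
        proof
          fix y assume "y \<in> B g (\<theta> * rh n)"
          then have y: "dist g y \<le> \<theta> * rh n" by (rule dist_le_of_B)
          also have "\<dots> < \<eta> * rh n" using \<theta> rh by simp
          finally have "dist y g < ps n" using n(2) by (simp add: dist_commute)
          then have "y \<in> thickening (D n g) (ps n)"
            using D_mem[of g n] g G(2) by (auto simp: thickening_iff)
          moreover have "\<theta> * rh n \<le> 1 * rh n" using \<theta> rh by (intro mult_right_mono) auto
          ultimately show "y \<in> W \<inter> level n"
            using G(4)[rule_format, OF g] G(2) g y by (auto simp: level_def)
        qed
        then show "(\<Union>g\<in>G. B g (\<theta> * rh n)) \<subseteq> W \<inter> (\<Union>n\<in>{N..}. level n)"
          using n(1) by blast
      qed (use W level_sets in auto)
      finally have 1: "(\<Sum>g\<in>G. prob (B g (\<theta> * rh n))) \<le> prob (W \<inter> (\<Union>n\<in>{N..}. level n))" .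
      have "prob (B g (4 * rh n)) \<le> C ^ k * prob (B g (\<theta> * rh n))" for g
      proof -
        have "4 \<le> 2 ^ k * \<theta>" using k \<theta> by (simp add: field_simps)
        then have "4 * rh n \<le> 2 ^ k * \<theta> * rh n" using rh by (intro mult_right_mono) auto
        then have "B g (4 * rh n) \<subseteq> B g (2 ^ k * (\<theta> * rh n))"
          using B_cases by (auto simp: mult.assoc)
        then have "prob (B g (4 * rh n)) \<le> prob (B g (2 ^ k * (\<theta> * rh n)))"
          using \<theta> rh B_sets by (intro finite_measure_mono) auto
        also have "\<dots> \<le> C ^ k * prob (B g (\<theta> * rh n))"
          using \<theta> rh by (intro doubling_power) auto
        finally show ?thesis .
      qed
      then have "\<kappa> * prob W \<le> C ^ k * (\<Sum>g\<in>G. prob (B g (\<theta> * rh n)))"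
        using G(5) unfolding sum_distrib_left by (meson order_trans sum_mono)
      also have "\<dots> \<le> C ^ k * prob (W \<inter> (\<Union>n\<in>{N..}. level n))"
        using 1 C_ge1 by (intro mult_left_mono) auto
      finally show ?thesis using C_ge1 by (simp add: field_simps)
    qed
    then show "\<exists>N0. \<forall>N\<ge>N0. \<kappa> / C ^ k * prob W \<le> prob (W \<inter> (\<Union>n\<in>{N..}. level n))"
      by blast
  qed
  then show ?thesis
    using \<open>0 < \<kappa>\<close> C_ge1 by (metis divide_pos_pos zero_less_power less_le_trans zero_less_one)
qed

text \<open>This is the density bound with \<open>V\<close> and \<open>W\<close> both equal to the
  whole space, where any \<delta> is admissible.\<close>

lemma prob_limsup_level_pos:
  assumes "density_bound \<kappa> c" "0 < c"
    and "\<forall>\<^sub>F n in sequentially. \<kappa> \<le> prob (thickening (X n) (rh n))"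
  shows "0 < prob limsup_level"
proof -
  have "UNIV \<in> sets m" using sets.top[of m] space_UNIV by simp
  moreover have "prob UNIV = 1" using prob_space space_UNIV by simp
  ultimately have "c \<le> prob limsup_level"
    using assms(1)[unfolded density_bound_def, rule_format, of UNIV 1 UNIV] assms(3) by simp
  then show ?thesis using assms(2) by simp
qed

text \<open>The complement of the limsup set is an increasing union of closed sets \<open>F\<close>. If some \<open>F\<close> had
  positive measure, the density bound on its shrinking neighbourhoods would survive in the limit,
  although the limsup set misses \<open>F\<close>.\<close>

lemma prob_limsup_level_eq_1:
  assumes dens: "\<And>\<kappa>. 0 < \<kappa> \<Longrightarrow> \<exists>c>0. density_bound \<kappa> c"
    and "0 < r0" "0 < \<kappa>"
    and loc: "\<And>x r. 0 < r \<Longrightarrow> r \<le> r0 \<Longrightarrow>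
      \<forall>\<^sub>F n in sequentially. \<kappa> * prob (B x r) \<le> prob (B x r \<inter> thickening (X n) (rh n))"
  shows "prob limsup_level = 1"
proof -
  have zero: "prob F = 0" if F: "F = - (\<Union>n\<in>{k..}. level n)" for F k
  proof (rule ccontr)
    assume "prob F \<noteq> 0"
    then have Fpos: "0 < prob F" by (simp add: zero_less_measure_iff)
    have "closed F" unfolding F using open_level by (auto intro: closed_Compl)
    have FL: "F \<inter> limsup_level = {}" unfolding F limsup_level_def by auto
    have Fs: "F \<in> sets m"
      using sets.compl_sets[of "\<Union>n\<in>{k..}. level n" m] level_sets space_UNIV
      unfolding F by (auto simp: Compl_eq_Diff_UNIV)
    define U where "U j = thickening F (1 / Suc j)" for j
    have Us: "U j \<in> sets m" for j by (auto simp: U_def open_sets open_thickening)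
    have FU: "F \<subseteq> U j" for j
    proof
      fix x assume "x \<in> F"
      then show "x \<in> U j" by (auto simp: U_def thickening_iff intro!: bexI[of _ x])
    qed
    have "decseq U"
    proof (rule decseq_SucI, rule subsetI)
      fix j x assume "x \<in> U (Suc j)"
      moreover have "1 / real (Suc (Suc j)) \<le> 1 / real (Suc j)" by (intro frac_le) auto
      ultimately show "x \<in> U j" unfolding U_def thickening_iff by (meson less_le_trans)
    qed
    moreover have "(\<Inter>j. U j) = F"
    proof
      show "(\<Inter>j. U j) \<subseteq> F"
      proof
        fix x assume x: "x \<in> (\<Inter>j. U j)"
        show "x \<in> F"
        proof (rule closed_approachable[OF \<open>closed F\<close>, THEN iffD1], intro allI impI)
          fix e :: real assume "0 < e"
          then obtain j where "1 / Suc j < e" by (meson nat_approx_posE)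
          moreover obtain a where "a \<in> F" "dist x a < 1 / Suc j"
            using x by (auto simp: U_def thickening_iff)
          ultimately show "\<exists>y\<in>F. dist y x < e" by (auto simp: dist_commute intro!: bexI[of _ a])
        qed
      qed
    qed (use FU in auto)
    ultimately have lim: "(\<lambda>j. prob (U j)) \<longlonglongrightarrow> prob F"
      using finite_Lim_measure_decseq[of U] Us by auto
    \<comment> \<open>Balls of radius \<open>4 * r\<close> around a net in \<open>F\<close> cover
      \<open>F\<close>, so those of radius \<open>r\<close> have total measure at least
      \<open>prob F / C ^ 2\<close>, and local ubiquity retains the proportion \<kappa>. No
      \<open>j\<close> occurs here, so \<open>c\<close> is fixed before the neighbourhood
      shrinks.\<close>
    define \<kappa>' where "\<kappa>' = \<kappa> * prob F / C ^ 2"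
    have "0 < \<kappa>'" using assms Fpos C_ge1 by (simp add: \<kappa>'_def)
    then obtain c where c: "0 < c" "density_bound \<kappa>' c" using dens by blast
    \<comment> \<open>The limsup set misses \<open>F\<close>, so its share of \<open>U j\<close> has
      to fit into the remainder of \<open>U j\<close> outside \<open>F\<close>, whose measure tends
      to 0.\<close>
    have "c * prob F \<le> prob (U j) - prob F" for j
    proof -
      \<comment> \<open>Points within \<open>r\<close> of \<open>V\<close> are within
        \<open>2 * r\<close> of \<open>F\<close>, hence in \<open>U j\<close>. The
        \<open>3 * r\<close>-separation below makes balls of radius \<open>r\<close> disjoint even
        when closed, and as they are finitely many, one threshold on \<open>n\<close> gives local
        ubiquity for all of them.\<close>
      define r where "r = min r0 (1 / (4 * Suc j))"
      have r: "0 < r" "r \<le> r0" "4 * r \<le> 1 / Suc j" using assms by (auto simp: r_def min_def field_simps)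
      have "0 < 3 * r" using r(1) by simp
      then obtain G where G: "finite G" "G \<subseteq> F" "pairwise (\<lambda>x y. 3 * r \<le> dist x y) G"
          "F \<subseteq> (\<Union>x\<in>G. ball x (3 * r))"
        by (rule separated_net[OF compact_UNIV, where A = F])
      define V where "V = (\<Union>g\<in>G. B g r)"
      have "ball v r \<subseteq> U j" if v: "v \<in> V" for v
      proof
        fix y assume y: "y \<in> ball v r"
        obtain g where g: "g \<in> G" "dist g v \<le> r" using v dist_le_of_B by (auto simp: V_def)
        have "dist y g < 1 / Suc j"
          using dist_triangle[of g y v] g(2) y r by (simp add: dist_commute)
        then show "y \<in> U j" using g G(2) by (auto simp: U_def thickening_iff)
      qed
      moreover have "\<forall>\<^sub>F n in sequentially. \<kappa>' * prob (U j) \<le> prob (V \<inter> thickening (X n) (rh n))"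
      proof -
        have dis: "disjoint_family_on (\<lambda>g. B g r) G"
          unfolding disjoint_family_on_def
        proof (intro ballI impI, rule ccontr)
          fix x y assume xy: "x \<in> G" "y \<in> G" "x \<noteq> y" "B x r \<inter> B y r \<noteq> {}"
          then obtain z where z: "z \<in> B x r" "z \<in> B y r" by auto
          have "dist x y \<le> 2 * r"
            using dist_triangle2[of x y z] dist_le_of_B[OF z(1)] dist_le_of_B[OF z(2)] by simp
          then show False using pairwiseD[OF G(3) xy(1-3)] r by simp
        qed
        have "prob F \<le> prob (\<Union>g\<in>G. B g (2 ^ 2 * r))"
        proof (rule finite_measure_mono)
          have "ball x (3 * r) \<subseteq> B x (2 ^ 2 * r)" for x
            using r by (auto intro!: in_B_of_dist)
          then show "F \<subseteq> (\<Union>g\<in>G. B g (2 ^ 2 * r))" using G(4) by blast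
        qed (use G r B_sets in auto)
        also have "\<dots> \<le> (\<Sum>g\<in>G. prob (B g (2 ^ 2 * r)))"
          using G r B_sets by (intro finite_measure_subadditive_finite) auto
        also have "\<dots> \<le> (\<Sum>g\<in>G. C ^ 2 * prob (B g r))"
          using r by (intro sum_mono doubling_power)
        finally have Fle: "prob F \<le> C ^ 2 * (\<Sum>g\<in>G. prob (B g r))" by (simp add: sum_distrib_left)
        have "\<forall>\<^sub>F n in sequentially. \<forall>g\<in>G. \<kappa> * prob (B g r) \<le> prob (B g r \<inter> thickening (X n) (rh n))"
          using G(1) loc r by (intro eventually_ball_finite) auto
        then show ?thesis
        proof eventually_elim
          case (elim n)
          have T: "thickening (X n) (rh n) \<in> sets m" by (simp add: open_sets open_thickening)
          have "\<kappa>' * prob (U j) \<le> \<kappa>' * 1"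
            using \<open>0 < \<kappa>'\<close> by (intro mult_left_mono) auto
          also have "\<dots> \<le> \<kappa> * (\<Sum>g\<in>G. prob (B g r))"
            using Fle C_ge1 assms(3) by (simp add: \<kappa>'_def field_simps)
          also have "\<dots> \<le> (\<Sum>g\<in>G. prob (B g r \<inter> thickening (X n) (rh n)))"
            unfolding sum_distrib_left using elim by (intro sum_mono) auto
          also have "\<dots> = prob (\<Union>g\<in>G. B g r \<inter> thickening (X n) (rh n))"
            using G(1) dis B_sets r T
            by (intro finite_measure_finite_Union[symmetric]) (auto simp: disjoint_family_on_def)
          also have "(\<Union>g\<in>G. B g r \<inter> thickening (X n) (rh n)) = V \<inter> thickening (X n) (rh n)"
            by (auto simp: V_def)
          finally show ?case .
        qed
      qed
      ultimately have "c * prob (U j) \<le> prob (U j \<inter> limsup_level)"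
        using c(2)[unfolded density_bound_def, rule_format, of "U j" r V] Us r by auto
      also have "\<dots> \<le> prob (U j - F)"
        using FL Us Fs by (intro finite_measure_mono) auto
      also have "\<dots> = prob (U j) - prob F"
        using FU Us Fs by (intro finite_measure_Diff) auto
      finally show ?thesis
        using mult_left_mono[OF finite_measure_mono[OF FU Us, of j], of c] c(1) by linarith
    qed
    then have "c * prob F \<le> prob F - prob F"
      using lim by (intro LIMSEQ_le_const[where X = "\<lambda>j. prob (U j) - prob F"] tendsto_diff) auto
    then show False using c Fpos by (simp add: mult_le_0_iff)
  qed
  \<comment> \<open>The complement of each tail union is null, and continuity from above passes to
    the intersection of the tails.\<close>
  have "prob (\<Union>n\<in>{k..}. level n) = 1" for k
  proof -
    have "(\<Union>n\<in>{k..}. level n) \<in> sets m" using level_sets by auto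
    then show ?thesis
      using zero[OF refl, of k] prob_compl[of "\<Union>n\<in>{k..}. level n"] space_UNIV
      by (simp add: Compl_eq_Diff_UNIV)
  qed
  moreover have "UNIV \<in> sets m" using sets.top[of m] space_UNIV by simp
  moreover have "prob UNIV = 1" using prob_space space_UNIV by simp
  ultimately have "1 \<le> prob (UNIV \<inter> limsup_level)"
    unfolding limsup_level_def using level_sets by (intro measure_limsup_ge) auto
  then show ?thesis by (simp add: antisym)
qed

end

subsection \<open>Pairwise quasi-independence\<close>

text \<open>The pair sum of \<open>chung_erdos\<close> splits into the diagonal and two symmetric
  halves. Overlaps are thus needed only for \<open>s < t\<close>, which suits bounds
  \<open>h\<close> that are not symmetric in the two levels.\<close>

lemma (in finite_measure) chung_erdos_weighted:
  fixes A :: "nat \<Rightarrow> 'a set" and v :: "nat \<Rightarrow> real" and h :: "nat \<Rightarrow> nat \<Rightarrow> real"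
  assumes I: "finite I" and A: "\<And>n. n \<in> I \<Longrightarrow> A n \<in> sets M" and "0 \<le> e"
    and v: "\<And>n. n \<in> I \<Longrightarrow> 0 \<le> v n"
    and lower: "\<And>n. n \<in> I \<Longrightarrow> e * v n \<le> measure M (A n)"
    and diag: "\<And>n. n \<in> I \<Longrightarrow> measure M (A n) \<le> L * v n"
    and cross: "\<And>s t. s \<in> I \<Longrightarrow> t \<in> I \<Longrightarrow> s < t \<Longrightarrow> measure M (A s \<inter> A t) \<le> L * h s t"
  shows "(e * sum v I)\<^sup>2
    \<le> measure M (\<Union>n\<in>I. A n) * (L * (sum v I + 2 * (\<Sum>s\<in>I. \<Sum>t\<in>I. if s < t then h s t else 0)))"
proof -
  define k where "k s t = (if s < t then h s t else 0)" for s t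
  have "(e * sum v I)\<^sup>2 \<le> (\<Sum>n\<in>I. measure M (A n))\<^sup>2"
    unfolding sum_distrib_left
    using lower v \<open>0 \<le> e\<close> by (intro power_mono sum_mono sum_nonneg) auto
  also have "\<dots> \<le> measure M (\<Union>n\<in>I. A n) * (\<Sum>s\<in>I. \<Sum>t\<in>I. measure M (A s \<inter> A t))"
    using I A by (rule chung_erdos)
  also have "(\<Sum>s\<in>I. \<Sum>t\<in>I. measure M (A s \<inter> A t))
      \<le> (\<Sum>s\<in>I. \<Sum>t\<in>I. L * ((if s = t then v s else 0) + k s t + k t s))"
  proof (intro sum_mono)
    fix s t assume st: "s \<in> I" "t \<in> I"
    consider "s = t" | "s < t" | "t < s" by linarith
    then show "measure M (A s \<inter> A t) \<le> L * ((if s = t then v s else 0) + k s t + k t s)"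
      using diag[of s] cross[of s t] cross[of t s] st by cases (auto simp: k_def Int_commute)
  qed
  also have "\<dots> = L * (sum v I + 2 * (\<Sum>s\<in>I. \<Sum>t\<in>I. k s t))"
  proof -
    have "(\<Sum>s\<in>I. \<Sum>t\<in>I. k t s) = (\<Sum>s\<in>I. \<Sum>t\<in>I. k s t)" by (rule sum.swap)
    moreover have "(\<Sum>s\<in>I. \<Sum>t\<in>I. if s = t then v s else 0) = sum v I"
      using I by simp
    ultimately show ?thesis
      by (simp add: sum_distrib_left[symmetric] sum.distrib)
  qed
  finally show ?thesis by (simp add: k_def mult_left_mono)
qed

text \<open>\<open>p n\<close> and \<open>q n\<close> are the measures of the generic balls of radii \<open>\<psi>(u\<^sub>n)\<close> and \<open>\<rho>(u\<^sub>n)\<close>.\<close>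

locale weighted_blocks = resonant_blocks m B C X D rh ps
  for m :: "'a::metric_space measure" and B C X D rh ps +
  fixes p q :: "nat \<Rightarrow> real" and b c1 c2 \<gamma> K :: real and N1 :: nat
  assumes b_ge1: "1 \<le> b" and c1_pos: "0 < c1" and c2_ge1: "1 \<le> c2" and \<gamma>_nonneg: "0 \<le> \<gamma>"
    and K_nonneg: "0 \<le> K" and N1_ge1: "1 \<le> N1"
    and p_pos: "\<And>n. 1 \<le> n \<Longrightarrow> 0 < p n" and q_pos: "\<And>n. 1 \<le> n \<Longrightarrow> 0 < q n"
    and ps_le: "\<And>n. N1 \<le> n \<Longrightarrow> ps n \<le> rh n"
    and p_le: "\<And>n c. N1 \<le> n \<Longrightarrow> c \<in> X n \<Longrightarrow> p n \<le> b * prob (B c (ps n))"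
    and le_p: "\<And>n c. N1 \<le> n \<Longrightarrow> c \<in> X n \<Longrightarrow> prob (B c (ps n)) \<le> b * p n"
    and q_le: "\<And>n c. N1 \<le> n \<Longrightarrow> c \<in> X n \<Longrightarrow> q n \<le> b * prob (B c (rh n))"
    and le_q: "\<And>n c. N1 \<le> n \<Longrightarrow> c \<in> X n \<Longrightarrow> prob (B c (rh n)) \<le> b * q n"
    and ball_compare: "\<And>n c c' r. N1 \<le> n \<Longrightarrow> c \<in> X n \<Longrightarrow> c' \<in> X n \<Longrightarrow> 0 < r \<Longrightarrow> r \<le> rh n \<Longrightarrow>
      prob (B c r) \<le> b * prob (B c' r)"
    and intersection_lower: "\<And>n c. N1 \<le> n \<Longrightarrow> c \<in> X n \<Longrightarrow>
      c1 * prob (B c (ps n)) * (rh n / ps n) powr \<gamma>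
        \<le> prob (B c (rh n / 2) \<inter> thickening (D n c) (ps n))"
    and intersection_upper: "\<And>n c t k x r. N1 \<le> n \<Longrightarrow> c \<in> X n \<Longrightarrow> 0 < t \<Longrightarrow> t \<le> rh n \<Longrightarrow>
      x \<in> X k \<Longrightarrow> 0 < r \<Longrightarrow> r \<le> 3 * rh n \<Longrightarrow>
      prob (B x r \<inter> B c (3 * rh n) \<inter> thickening (D n c) (3 * t)) \<le> c2 * prob (B c t) * (r / t) powr \<gamma>"
    and divergence: "filterlim (\<lambda>Q. \<Sum>n=1..Q. p n / q n * (rh n / ps n) powr \<gamma>) at_top sequentially"
    and quasi_independence: "\<forall>\<^sub>F Q in sequentially.
      (\<Sum>s\<in>{1..<Q}. rh s powr \<gamma> / q s *
         (\<Sum>t\<in>{t. s + 1 \<le> t \<and> t \<le> Q \<and> ps s < rh t}. p t / ps t powr \<gamma>))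
      \<le> K * (\<Sum>n=1..Q. p n / q n * (rh n / ps n) powr \<gamma>)\<^sup>2"
begin

text \<open>This is the term of the divergent series. Up to constants it is the measure of the union
  of pieces of level \<open>n\<close> relative to \<open>prob W\<close>.\<close>

definition vol :: "nat \<Rightarrow> real" where
  "vol n = p n / q n * (rh n / ps n) powr \<gamma>"

text \<open>This is the \<open>(s, t)\<close> summand of the second hypothesis. Extending it by 0
  permits sums over full rectangles of indices.\<close>

definition overlap :: "nat \<Rightarrow> nat \<Rightarrow> real" where
  "overlap s t = (if ps s < rh t then rh s powr \<gamma> / q s * (p t / ps t powr \<gamma>) else 0)"

text \<open>Cutting with the half ball makes the pieces over a \<open>2 * rh n\<close>-separated set
  disjoint, and it is the shape in which the lower intersection condition bounds the
  measure.\<close>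

definition piece :: "nat \<Rightarrow> 'a \<Rightarrow> 'a set" where
  "piece n c = B c (rh n / 2) \<inter> thickening (D n c) (ps n)"

text \<open>A common constant for the three ways in which two levels can meet: in one piece only,
  with a bound by the product of volumes, or with a bound by \<open>overlap\<close>. The last case
  produces exactly this value.\<close>

definition H :: real where
  "H = b ^ 4 * C ^ 3 * c2 ^ 2 * 3 powr \<gamma>"

section \<open>Constants and the measure of a single piece\<close>

lemma ge_N1: "N1 \<le> n \<Longrightarrow> 1 \<le> n \<and> 0 < rh n \<and> 0 < ps n \<and> 0 < p n \<and> 0 < q n"
  using N1_ge1 rh_pos ps_pos p_pos q_pos by force

lemma vol_pos: "1 \<le> n \<Longrightarrow> 0 < vol n"
  using rh_pos[of n] ps_pos[of n] p_pos[of n] q_pos[of n] by (simp add: vol_def)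

lemma overlap_nonneg: "1 \<le> s \<Longrightarrow> 1 \<le> t \<Longrightarrow> 0 \<le> overlap s t"
  using p_pos[of t] q_pos[of s] by (simp add: overlap_def)

lemma q_vol: "N1 \<le> n \<Longrightarrow> q n * vol n = p n * (rh n / ps n) powr \<gamma>"
  using ge_N1[of n] by (simp add: vol_def)

lemma three_powr: "1 \<le> 3 powr \<gamma>"
  using \<gamma>_nonneg by (simp add: ge_one_powr_ge_zero)

lemma H_bounds: "c2 * b \<le> H" "b ^ 3 * C * c2 ^ 2 * 3 powr \<gamma> \<le> H" "0 < H"
proof -
  have pow: "1 \<le> b ^ k" "1 \<le> C ^ k" "1 \<le> c2 ^ k" for k
    using b_ge1 C_ge1 c2_ge1 by (auto simp: one_le_power)
  have "(b * 1 * (c2 ^ 1 * 1)) * 1 \<le> (b * b ^ 3 * (c2 ^ 1 * c2 ^ 1)) * (C ^ 3 * 3 powr \<gamma>)"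
    using pow[of 3] pow[of 1] three_powr mult_mono[OF pow(2)[of 3] three_powr]
    by (intro mult_mono) auto
  then show "c2 * b \<le> H" by (simp add: H_def power_numeral_reduce mult_ac)
  have "(b ^ 3 * 1 * (C * 1)) * (c2 ^ 2 * 3 powr \<gamma>) \<le> (b ^ 3 * b * (C * C ^ 2)) * (c2 ^ 2 * 3 powr \<gamma>)"
    using pow[of 1] pow[of 2] pow[of 3] by (intro mult_mono) auto
  then show "b ^ 3 * C * c2 ^ 2 * 3 powr \<gamma> \<le> H"
    by (simp add: H_def power_numeral_reduce mult_ac)
  show "0 < H" using b_ge1 C_ge1 c2_ge1 by (simp add: H_def)
qed

lemma piece_sets: "N1 \<le> n \<Longrightarrow> piece n c \<in> sets m"
  unfolding piece_def using ge_N1[of n] B_sets open_sets[OF open_thickening] by auto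

lemma piece_subset_level: "c \<in> X n \<Longrightarrow> piece n c \<subseteq> level n"
  by (auto simp: piece_def level_def)

text \<open>This is the upper intersection condition at \<open>t = ps n\<close>, whose enlarged sets
  contain the piece. The ball \<open>B x r\<close> may be centred in another block
  \<open>k\<close>.\<close>

lemma piece_inter_le:
  assumes "N1 \<le> n" "c \<in> X n" "x \<in> X k" "0 < r" "r \<le> 3 * rh n"
  shows "prob (B x r \<inter> piece n c) \<le> c2 * b * p n * (r / ps n) powr \<gamma>"
proof -
  note n = ge_N1[OF assms(1)]
  have "prob (B x r \<inter> piece n c) \<le> prob (B x r \<inter> B c (3 * rh n) \<inter> thickening (D n c) (3 * ps n))"
  proof (rule finite_measure_mono)
    have "B c (rh n / 2) \<subseteq> B c (3 * rh n)" using n B_cases by auto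
    moreover have "thickening (D n c) (ps n) \<subseteq> thickening (D n c) (3 * ps n)"
      using n by (force simp: thickening_iff)
    ultimately show "B x r \<inter> piece n c \<subseteq> B x r \<inter> B c (3 * rh n) \<inter> thickening (D n c) (3 * ps n)"
      by (auto simp: piece_def)
  qed (use n assms B_sets open_sets[OF open_thickening] in auto)
  also have "\<dots> \<le> c2 * prob (B c (ps n)) * (r / ps n) powr \<gamma>"
    using assms n ps_le[of n] by (intro intersection_upper) auto
  also have "\<dots> \<le> c2 * (b * p n) * (r / ps n) powr \<gamma>"
    using le_p[of n c] assms c2_ge1 by (intro mult_right_mono mult_left_mono) auto
  finally show ?thesis by (simp add: mult.assoc)
qed

lemma piece_le:
  assumes "N1 \<le> n" "c \<in> X n"
  shows "prob (piece n c) \<le> c2 * b * (q n * vol n)"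
proof -
  note n = ge_N1[OF assms(1)]
  have "prob (piece n c) \<le> prob (B c (rh n) \<inter> piece n c)"
    using n B_cases B_sets piece_sets[OF assms(1)]
    by (intro finite_measure_mono) (auto simp: piece_def)
  also have "\<dots> \<le> c2 * b * p n * (rh n / ps n) powr \<gamma>"
    using assms n by (intro piece_inter_le) auto
  finally show ?thesis using q_vol[OF assms(1)] by (simp add: mult.assoc)
qed

lemma piece_ge:
  assumes "N1 \<le> n" "c \<in> X n"
  shows "c1 / b * (q n * vol n) \<le> prob (piece n c)"
proof -
  note n = ge_N1[OF assms(1)]
  have "p n / b \<le> prob (B c (ps n))" using p_le[OF assms] b_ge1 by (simp add: field_simps)
  then have "c1 * (p n / b) * (rh n / ps n) powr \<gamma> \<le> c1 * prob (B c (ps n)) * (rh n / ps n) powr \<gamma>"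
    using c1_pos by (intro mult_right_mono mult_left_mono) auto
  also have "\<dots> \<le> prob (piece n c)" unfolding piece_def by (rule intersection_lower[OF assms])
  finally show ?thesis using q_vol[OF assms(1)] by simp
qed

text \<open>The half balls are disjoint, and each has measure at least \<open>q n / (b * C)\<close>.
  With \<open>S = W\<close> this bounds the size of a net; with \<open>S\<close> a neighbourhood of
  a resonant set it bounds the number of pieces meeting a piece of another level.\<close>

lemma card_separated_le:
  assumes "N1 \<le> n" "finite G" "G \<subseteq> X n" "pairwise (\<lambda>x y. 2 * rh n \<le> dist x y) G"
    and sub: "\<And>g. g \<in> G \<Longrightarrow> B g (rh n / 2) \<subseteq> S" and S: "S \<in> sets m"
  shows "card G * q n \<le> b * C * prob S"
proof -
  note n = ge_N1[OF assms(1)]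
  have "q n \<le> b * C * prob (B g (rh n / 2))" if "g \<in> G" for g
  proof -
    have "q n \<le> b * prob (B g (rh n))" using q_le assms that by blast
    also have "\<dots> \<le> b * (C * prob (B g (rh n / 2)))"
      using doubling[of "rh n / 2" g] n b_ge1 by (intro mult_left_mono) auto
    finally show ?thesis by (simp add: mult.assoc)
  qed
  then have "(\<Sum>g\<in>G. q n) \<le> (\<Sum>g\<in>G. b * C * prob (B g (rh n / 2)))"
    by (rule sum_mono)
  also have "\<dots> = b * C * prob (\<Union>g\<in>G. B g (rh n / 2))"
    unfolding sum_distrib_left[symmetric]
    using half_balls_disjoint[of n G] assms n B_sets
    by (subst finite_measure_finite_Union) auto
  also have "\<dots> \<le> b * C * prob S"
    using sub S b_ge1 C_ge1 by (intro mult_left_mono finite_measure_mono) auto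
  finally show ?thesis by simp
qed

section \<open>Overlap of two levels\<close>

lemma sum_piece_le:
  assumes "N1 \<le> t" "finite G" "G \<subseteq> X t"
  shows "prob (E \<inter> (\<Union>g\<in>G. piece t g))
    \<le> card {g\<in>G. E \<inter> piece t g \<noteq> {}} * (c2 * b * (q t * vol t))"
proof -
  define G' where "G' = {g\<in>G. E \<inter> piece t g \<noteq> {}}"
  have "E \<inter> (\<Union>g\<in>G. piece t g) \<subseteq> (\<Union>g\<in>G'. piece t g)" by (auto simp: G'_def)
  then have "prob (E \<inter> (\<Union>g\<in>G. piece t g)) \<le> prob (\<Union>g\<in>G'. piece t g)"
    using assms piece_sets by (intro finite_measure_mono) (auto simp: G'_def)
  also have "\<dots> \<le> (\<Sum>g\<in>G'. prob (piece t g))"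
    using assms piece_sets by (intro finite_measure_subadditive_finite) (auto simp: G'_def)
  also have "\<dots> \<le> (\<Sum>g\<in>G'. c2 * b * (q t * vol t))"
    using assms by (intro sum_mono piece_le) (auto simp: G'_def)
  finally show ?thesis by (simp add: G'_def)
qed

text \<open>A piece of level \<open>s\<close> is a neighbourhood of its resonant set at scale \<open>\<tau>\<close>, and it absorbs the
  disjoint balls around all pieces of level \<open>t\<close> that meet it; the upper intersection condition bounds
  its measure, hence their number.\<close>

lemma meeting_count:
  assumes s: "N1 \<le> s" "c \<in> X s" and t: "N1 \<le> t" and G: "finite G" "G \<subseteq> X t"
    "pairwise (\<lambda>x y. 2 * rh t \<le> dist x y) G"
    and \<tau>: "ps s \<le> \<tau>" "rh t \<le> \<tau>" "\<tau> \<le> rh s"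
  shows "card {g\<in>G. piece s c \<inter> piece t g \<noteq> {}} * q t
    \<le> b * C * (c2 * prob (B c \<tau>) * (3 * (rh s / \<tau>)) powr \<gamma>)"
proof -
  note ns = ge_N1[OF s(1)] and nt = ge_N1[OF t]
  \<comment> \<open>The ball is written twice to match the upper intersection condition with
    \<open>x = c\<close> and \<open>r = 3 * rh s\<close>.\<close>
  define S where "S = B c (3 * rh s) \<inter> B c (3 * rh s) \<inter> thickening (D s c) (3 * \<tau>)"
  \<comment> \<open>A point of this ball is within \<open>rh t\<close> of a common point
    \<open>z\<close> of the two pieces. Hence it is within \<open>rh t + ps s\<close>, less than
    \<open>3 * \<tau>\<close>, of the resonant set, and within \<open>3/2 * rh s\<close> of
    \<open>c\<close>.\<close>
  have "B g (rh t / 2) \<subseteq> S" if g: "g \<in> G" "piece s c \<inter> piece t g \<noteq> {}" for g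
  proof
    fix y assume "y \<in> B g (rh t / 2)"
    then have y: "dist g y \<le> rh t / 2" by (rule dist_le_of_B)
    obtain z where z: "z \<in> piece s c" "z \<in> piece t g" using g by auto
    have zc: "dist c z \<le> rh s / 2" and zg: "dist g z \<le> rh t / 2"
      using z dist_le_of_B[of z c "rh s / 2"] dist_le_of_B[of z g "rh t / 2"] by (auto simp: piece_def)
    obtain d where d: "d \<in> D s c" "dist z d < ps s"
      using z by (auto simp: piece_def thickening_iff)
    have yz: "dist y z \<le> rh t"
      using dist_triangle3[of y z g] y zg by simp
    have "dist c y < 3 * rh s"
      using dist_triangle[of c y z] zc yz \<tau> ns by (simp add: dist_commute)
    then have "y \<in> B c (3 * rh s)" by (rule in_B_of_dist)
    moreover have "dist y d < 3 * \<tau>"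
      using dist_triangle[of y d z] d(2) yz \<tau> ns by simp
    ultimately show "y \<in> S"
      using d(1) by (auto simp: S_def thickening_iff)
  qed
  moreover have "S \<in> sets m"
    unfolding S_def using ns B_sets open_sets[OF open_thickening] by auto
  ultimately have "card {g\<in>G. piece s c \<inter> piece t g \<noteq> {}} * q t \<le> b * C * prob S"
    using G t by (intro card_separated_le) (auto intro: pairwise_subset)
  also have "prob S \<le> c2 * prob (B c \<tau>) * (3 * rh s / \<tau>) powr \<gamma>"
    unfolding S_def using s ns \<tau> by (intro intersection_upper[where k = s]) auto
  finally show ?thesis
    using b_ge1 C_ge1 by (simp add: mult_left_mono)
qed

text \<open>At the scale \<open>\<tau> = ps s\<close> the measure of \<open>B c \<tau>\<close> is
  comparable to \<open>p s\<close>, so the number of meeting pieces is at most a constant times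
  \<open>q s * vol s / q t\<close>. Each contributes about \<open>q t * vol t\<close>, and the
  factor \<open>q t\<close> cancels.\<close>

lemma cross_small_scale:
  assumes s: "N1 \<le> s" "c \<in> X s" and t: "N1 \<le> t" and G: "finite G" "G \<subseteq> X t"
    "pairwise (\<lambda>x y. 2 * rh t \<le> dist x y) G"
    and "rh t \<le> ps s"
  shows "prob (piece s c \<inter> (\<Union>g\<in>G. piece t g)) \<le> H * (q s * (vol s * vol t))"
proof -
  note ns = ge_N1[OF s(1)] and nt = ge_N1[OF t]
  let ?k = "real (card {g\<in>G. piece s c \<inter> piece t g \<noteq> {}})"
  have v: "0 < vol s" "0 < vol t" using vol_pos ns nt by auto
  have "?k * q t \<le> b * C * (c2 * prob (B c (ps s)) * (3 * (rh s / ps s)) powr \<gamma>)"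
    using assms ps_le by (intro meeting_count) auto
  also have "\<dots> \<le> b * C * (c2 * (b * p s) * (3 * (rh s / ps s)) powr \<gamma>)"
    using le_p[OF s] b_ge1 C_ge1 c2_ge1 by (intro mult_left_mono mult_right_mono) auto
  also have "\<dots> = b ^ 2 * C * c2 * 3 powr \<gamma> * (q s * vol s)"
    unfolding q_vol[OF s(1)] using ns by (subst powr_mult) (auto simp: power2_eq_square)
  finally have k: "?k * q t \<le> b ^ 2 * C * c2 * 3 powr \<gamma> * (q s * vol s)" .
  have "prob (piece s c \<inter> (\<Union>g\<in>G. piece t g)) \<le> ?k * (c2 * b * (q t * vol t))"
    using sum_piece_le[OF t G(1,2)] .
  also have "\<dots> = (?k * q t) * (c2 * b * vol t)" by simp
  also have "\<dots> \<le> (b ^ 2 * C * c2 * 3 powr \<gamma> * (q s * vol s)) * (c2 * b * vol t)"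
    using k v c2_ge1 b_ge1 by (intro mult_right_mono) auto
  also have "\<dots> = (b ^ 3 * C * c2 ^ 2 * 3 powr \<gamma>) * (q s * (vol s * vol t))"
    by (simp add: power2_eq_square power3_eq_cube)
  also have "\<dots> \<le> H * (q s * (vol s * vol t))"
    using H_bounds(2) v ns by (intro mult_right_mono) auto
  finally show ?thesis .
qed

text \<open>Nothing makes \<open>rh\<close> decreasing, so \<open>rh s < rh t\<close> can occur; then the piece of level \<open>s\<close> meets at
  most one piece of level \<open>t\<close>. Otherwise condition (M1) for block \<open>s\<close> moves the centre \<open>c\<close> to a point of
  the same resonant set near the pieces of level \<open>t\<close>.\<close>

lemma cross_large_scale:
  assumes s: "N1 \<le> s" "c \<in> X s" and t: "N1 \<le> t" and G: "finite G" "G \<subseteq> X t"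
    "pairwise (\<lambda>x y. 2 * rh t \<le> dist x y) G"
    and lt: "ps s < rh t"
  shows "prob (piece s c \<inter> (\<Union>g\<in>G. piece t g)) \<le> H * (q s * overlap s t)"
proof -
  note ns = ge_N1[OF s(1)] and nt = ge_N1[OF t]
  define G' where "G' = {g\<in>G. piece s c \<inter> piece t g \<noteq> {}}"
  have ov: "q s * overlap s t = rh s powr \<gamma> * (p t / ps t powr \<gamma>)"
    using lt ns by (simp add: overlap_def)
  have ov0: "0 \<le> q s * overlap s t" unfolding ov using nt by simp
  show ?thesis
  proof (cases "rh t \<le> rh s")
    case True
    show ?thesis
    proof (cases "G' = {}")
      case True
      then have "piece s c \<inter> (\<Union>g\<in>G. piece t g) = {}" by (auto simp: G'_def)
      then show ?thesis using ov0 H_bounds(3) by simp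
    next
      case False
      then obtain g z where g: "g \<in> G" and z: "z \<in> piece s c" "z \<in> piece t g"
        by (auto simp: G'_def)
      obtain d where d: "d \<in> D s c" "dist z d < ps s"
        using z by (auto simp: piece_def thickening_iff)
      have zg: "dist g z \<le> rh t / 2"
        using z dist_le_of_B[of z g "rh t / 2"] by (auto simp: piece_def)
      \<comment> \<open>The aim is to bound this by \<open>q t\<close> although \<open>c\<close>
        belongs to block \<open>s\<close>. The point \<open>d\<close> of block \<open>s\<close> is
        within \<open>3/2 * rh t\<close> of \<open>g\<close>, so \<open>B d (rh t)\<close> lies in
        \<open>B g (4 * rh t)\<close>, and doubling applies at \<open>g\<close>.\<close>
      have "prob (B c (rh t)) \<le> b * prob (B d (rh t))"
        using s d(1) D_subset[OF s(2)] nt \<open>rh t \<le> rh s\<close> by (intro ball_compare) auto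
      also have "prob (B d (rh t)) \<le> prob (B g (2 ^ 2 * rh t))"
      proof (rule finite_measure_mono)
        show "B d (rh t) \<subseteq> B g (2 ^ 2 * rh t)"
        proof
          fix y assume "y \<in> B d (rh t)"
          then have "dist d y \<le> rh t" by (rule dist_le_of_B)
          then have "dist g y < 2 ^ 2 * rh t"
            using dist_triangle[of g y z] dist_triangle[of z y d] d(2) zg lt nt by simp
          then show "y \<in> B g (2 ^ 2 * rh t)" by (rule in_B_of_dist)
        qed
      qed (use nt B_sets in auto)
      also have "\<dots> \<le> C ^ 2 * prob (B g (rh t))" using nt by (intro doubling_power) auto
      also have "prob (B g (rh t)) \<le> b * q t" using le_q t g G(2) by blast
      finally have c: "prob (B c (rh t)) \<le> b ^ 2 * C ^ 2 * q t"
        using b_ge1 C_ge1 by (simp add: mult_left_mono power2_eq_square mult_ac)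
      \<comment> \<open>At the scale \<open>\<tau> = rh t\<close> the factor \<open>q t\<close>
        cancels from the count. The powers of \<open>rh t\<close> then cancel against those in
        \<open>vol t\<close>, and \<open>overlap s t\<close> remains.\<close>
      have "card G' * q t \<le> b * C * (c2 * prob (B c (rh t)) * (3 * (rh s / rh t)) powr \<gamma>)"
        unfolding G'_def using assms \<open>rh t \<le> rh s\<close> by (intro meeting_count) auto
      also have "\<dots> \<le> b * C * (c2 * (b ^ 2 * C ^ 2 * q t) * (3 * (rh s / rh t)) powr \<gamma>)"
        using c b_ge1 C_ge1 c2_ge1 by (intro mult_left_mono mult_right_mono) auto
      also have "\<dots> = b ^ 3 * C ^ 3 * c2 * 3 powr \<gamma> * (rh s / rh t) powr \<gamma> * q t"
        using ns nt by (subst powr_mult) (auto simp: power2_eq_square power3_eq_cube)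
      finally have k: "card G' \<le> b ^ 3 * C ^ 3 * c2 * 3 powr \<gamma> * (rh s / rh t) powr \<gamma>"
        using nt by simp
      have "prob (piece s c \<inter> (\<Union>g\<in>G. piece t g)) \<le> card G' * (c2 * b * (q t * vol t))"
        using sum_piece_le[OF t G(1,2)] unfolding G'_def .
      also have "\<dots> \<le> (b ^ 3 * C ^ 3 * c2 * 3 powr \<gamma> * (rh s / rh t) powr \<gamma>) * (c2 * b * (q t * vol t))"
        using k vol_pos[of t] nt c2_ge1 b_ge1 by (intro mult_right_mono) auto
      also have "\<dots> = H * ((rh s / rh t) powr \<gamma> * (p t * (rh t / ps t) powr \<gamma>))"
        unfolding q_vol[OF t] H_def by (simp add: power_numeral_reduce)
      also have "(rh s / rh t) powr \<gamma> * (p t * (rh t / ps t) powr \<gamma>) = q s * overlap s t"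
        unfolding ov using ns nt by (simp add: powr_divide)
      finally show ?thesis .
    qed
  next
    case False
    show ?thesis
    proof (cases "piece s c \<inter> (\<Union>g\<in>G. piece t g) = {}")
      case True
      then show ?thesis using ov0 H_bounds(3) by simp
    next
      case nonempty: False
      \<comment> \<open>Strictness comes from \<open>rh s < rh t\<close>: two net points this close
        to \<open>c\<close> would be less than \<open>2 * rh t\<close> apart.\<close>
      have near: "dist g c < rh t" if g: "piece s c \<inter> piece t g \<noteq> {}" for g
      proof -
        obtain z where "z \<in> B c (rh s / 2)" "z \<in> B g (rh t / 2)"
          using g by (auto simp: piece_def)
        then have "dist c z \<le> rh s / 2" "dist g z \<le> rh t / 2" by (auto dest: dist_le_of_B)
        then show ?thesis using dist_triangle2[of g c z] False by simp
      qed
      obtain g where g: "g \<in> G" "piece s c \<inter> piece t g \<noteq> {}" using nonempty by blast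
      have "g' = g" if g': "g' \<in> G" "piece s c \<inter> piece t g' \<noteq> {}" for g'
      proof (rule ccontr)
        assume "g' \<noteq> g"
        then have "2 * rh t \<le> dist g' g" using G(3) g g' by (auto dest: pairwiseD)
        then show False using near[OF g(2)] near[OF g'(2)] dist_triangle2[of g' g c] by simp
      qed
      then have "piece s c \<inter> (\<Union>g\<in>G. piece t g) \<subseteq> piece t g" by blast
      moreover have "piece s c \<subseteq> B c (rh s)" using B_cases ns by (auto simp: piece_def)
      ultimately have "prob (piece s c \<inter> (\<Union>g\<in>G. piece t g)) \<le> prob (B c (rh s) \<inter> piece t g)"
        using ns B_sets piece_sets[OF t] by (intro finite_measure_mono) blast+
      \<comment> \<open>Here the two blocks mix: the ball is centred at \<open>c\<close> in block
        \<open>s\<close> while the piece belongs to block \<open>t\<close>. The radius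
        \<open>rh s\<close> is admissible because it is below \<open>rh t\<close>.\<close>
      also have "\<dots> \<le> c2 * b * p t * (rh s / ps t) powr \<gamma>"
        using s t g(1) G(2) ns nt False by (intro piece_inter_le) auto
      also have "\<dots> = c2 * b * (q s * overlap s t)"
        unfolding ov using ns nt by (simp add: powr_divide)
      also have "\<dots> \<le> H * (q s * overlap s t)"
        using H_bounds(1) ov0 by (intro mult_right_mono) auto
      finally show ?thesis .
    qed
  qed
qed

lemma cross_le:
  assumes s: "N1 \<le> s" "c \<in> X s" and t: "N1 \<le> t" and G: "finite G" "G \<subseteq> X t"
    "pairwise (\<lambda>x y. 2 * rh t \<le> dist x y) G"
  shows "prob (piece s c \<inter> (\<Union>g\<in>G. piece t g)) \<le> H * (q s * (vol s * vol t + overlap s t))"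
proof -
  note ns = ge_N1[OF s(1)] and nt = ge_N1[OF t]
  have "0 \<le> H * (q s * (vol s * vol t))" "0 \<le> H * (q s * overlap s t)"
    using ns nt vol_pos[of s] vol_pos[of t] overlap_nonneg[of s t] H_bounds(3) by auto
  moreover have "prob (piece s c \<inter> (\<Union>g\<in>G. piece t g)) \<le> H * (q s * (vol s * vol t)) \<or>
      prob (piece s c \<inter> (\<Union>g\<in>G. piece t g)) \<le> H * (q s * overlap s t)"
    using cross_small_scale[OF assms] cross_large_scale[OF assms] by linarith
  ultimately show ?thesis by (auto simp: distrib_left)
qed

section \<open>Second moment estimate over all levels\<close>

lemma sum_overlap_le:
  assumes "1 \<le> N"
  shows "(\<Sum>s=N..Q. \<Sum>t=N..Q. if s < t then overlap s t else 0)
    \<le> (\<Sum>s\<in>{1..<Q}. rh s powr \<gamma> / q s *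
         (\<Sum>t\<in>{t. s + 1 \<le> t \<and> t \<le> Q \<and> ps s < rh t}. p t / ps t powr \<gamma>))"
    (is "?L \<le> sum ?R {1..<Q}")
proof -
  have R0: "0 \<le> ?R s" if "1 \<le> s" for s
    using that by (intro mult_nonneg_nonneg sum_nonneg divide_nonneg_nonneg)
      (auto intro!: less_imp_le[OF p_pos] less_imp_le[OF q_pos])
  have le: "(\<Sum>t=N..Q. if s < t then overlap s t else 0) \<le> ?R s" if "1 \<le> s" for s
  proof -
    have "(\<Sum>t=N..Q. if s < t then overlap s t else 0)
        = (\<Sum>t\<in>{t\<in>{N..Q}. s < t \<and> ps s < rh t}. rh s powr \<gamma> / q s * (p t / ps t powr \<gamma>))"
      by (subst sum.inter_filter) (auto simp: overlap_def intro!: sum.cong)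
    also have "\<dots> \<le> (\<Sum>t\<in>{t. s + 1 \<le> t \<and> t \<le> Q \<and> ps s < rh t}. rh s powr \<gamma> / q s * (p t / ps t powr \<gamma>))"
    proof (rule sum_mono2)
      show "finite {t. s + 1 \<le> t \<and> t \<le> Q \<and> ps s < rh t}"
        by (rule finite_subset[of _ "{..Q}"]) auto
      fix t assume "t \<in> {t. s + 1 \<le> t \<and> t \<le> Q \<and> ps s < rh t} - {t\<in>{N..Q}. s < t \<and> ps s < rh t}"
      then have "0 < p t" by (intro p_pos) auto
      then show "0 \<le> rh s powr \<gamma> / q s * (p t / ps t powr \<gamma>)"
        using q_pos[OF that] by simp
    qed auto
    finally show ?thesis by (simp only: sum_distrib_left)
  qed
  \<comment> \<open>The row \<open>s = Q\<close> is empty, because no \<open>t \<le> Q\<close>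
    exceeds it; the hypothesis sums only up to \<open>Q - 1\<close>.\<close>
  have "?L = (\<Sum>s=N..<Q. \<Sum>t=N..Q. if s < t then overlap s t else 0)"
    by (rule sum.mono_neutral_right) (auto intro!: sum.neutral)
  also have "\<dots> \<le> (\<Sum>s=N..<Q. ?R s)" using assms by (intro sum_mono le) auto
  also have "\<dots> \<le> sum ?R {1..<Q}" using assms R0 by (intro sum_mono2) auto
  finally show ?thesis .
qed

text \<open>The sum of the measures of the \<open>A n\<close> grows like \<open>prob W\<close> times
  the sum of the volumes, while the pair sum is at most \<open>prob W\<close> times its square, up
  to constants. The Chung-Erdos quotient is therefore linear in \<open>prob W\<close>, as uniformity
  in \<open>W\<close> requires.\<close>

lemma density_bound_of_divergence:
  assumes "0 < \<kappa>"
  shows "\<exists>c>0. density_bound \<kappa> c"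
proof -
  \<comment> \<open>The covering balls give
    \<open>\<kappa> * prob W \<le> card (G n) * C ^ 2 * b * q n\<close>, and each piece has measure
    at least \<open>c1 / b * (q n * vol n)\<close>.\<close>
  define e where "e = c1 * \<kappa> / (b ^ 2 * C ^ 2)"
  \<comment> \<open>The 4 is the square of the loss in \<open>S Q / 2 \<le> S'\<close>;
    \<open>3 + 2 * K\<close> collects the diagonal, twice the product terms and twice the
    overlaps.\<close>
  define c where "c = e\<^sup>2 / (4 * (H * b * C * (3 + 2 * K)))"
  have e: "0 < e" using assms c1_pos b_ge1 C_ge1 by (simp add: e_def)
  have den: "0 < H * b * C * (3 + 2 * K)"
    using H_bounds(3) b_ge1 C_ge1 K_nonneg by simp
  have c: "0 < c" using e den by (simp add: c_def)
  have "density_bound \<kappa> c"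
  proof (rule density_boundI)
    fix V W :: "'a set" and \<delta> :: real
    assume W: "W \<in> sets m" and \<delta>: "0 < \<delta>" and V: "\<And>v. v \<in> V \<Longrightarrow> ball v \<delta> \<subseteq> W"
      and ev: "\<forall>\<^sub>F n in sequentially. \<kappa> * prob W \<le> prob (V \<inter> thickening (X n) (rh n))"
    obtain N0 where N0: "1 \<le> N0"
      "\<And>n. N0 \<le> n \<Longrightarrow> 2 * rh n < \<delta> \<and> \<kappa> * prob W \<le> prob (V \<inter> thickening (X n) (rh n))"
      using eventually_level_density[OF \<delta> ev] by blast
    define N2 where "N2 = max N0 N1"
    define net where "net n G \<longleftrightarrow> finite G \<and> G \<subseteq> X n \<and> pairwise (\<lambda>x y. 2 * rh n \<le> dist x y) G \<and>
        (\<forall>g\<in>G. cball g (rh n) \<subseteq> W) \<and> \<kappa> * prob W \<le> (\<Sum>g\<in>G. prob (B g (4 * rh n)))" for n G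
    have "\<exists>G. net n G" if "N2 \<le> n" for n
    proof -
      have n: "1 \<le> n" "2 * rh n < \<delta>" "\<kappa> * prob W \<le> prob (V \<inter> thickening (X n) (rh n))"
        using N0(1) N0(2)[of n] that by (auto simp: N2_def)
      show ?thesis unfolding net_def by (rule block_net[OF V n]) auto
    qed
    then obtain G where net: "\<And>n. N2 \<le> n \<Longrightarrow> net n (G n)" by metis
    have G: "finite (G n)" "G n \<subseteq> X n" "pairwise (\<lambda>x y. 2 * rh n \<le> dist x y) (G n)"
        "\<And>g. g \<in> G n \<Longrightarrow> cball g (rh n) \<subseteq> W"
        "\<kappa> * prob W \<le> (\<Sum>g\<in>G n. prob (B g (4 * rh n)))" if "N2 \<le> n" for n
      using net[OF that] unfolding net_def by simp_all
    define A where "A n = (\<Union>g\<in>G n. piece n g)" for n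
    define L where "L = H * b * C * prob W"
    have ge: "N1 \<le> n" if "N2 \<le> n" for n using that by (simp add: N2_def)
    have A_sets: "A n \<in> sets m" if "N2 \<le> n" for n
      unfolding A_def using G(1)[OF that] piece_sets[OF ge[OF that]] by auto
    have half_sub: "B g (rh n / 2) \<subseteq> W" if "N2 \<le> n" "g \<in> G n" for n g
    proof -
      have "B g (rh n / 2) \<subseteq> cball g (rh n)"
        using B_subset_cball[of g "rh n / 2"] ge_N1[OF ge[OF that(1)]] by auto
      then show ?thesis using G(4)[OF that] by blast
    qed
    have A_sub: "A n \<subseteq> W \<inter> level n" if n: "N2 \<le> n" for n
      using half_sub[OF n] piece_subset_level G(2)[OF n] unfolding A_def
      by (fastforce simp: piece_def)
    have card_le: "card (G n) * q n \<le> b * C * prob W" if n: "N2 \<le> n" for n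
      using card_separated_le[OF ge[OF n] G(1)[OF n] G(2)[OF n] G(3)[OF n] half_sub[OF n] W] by simp
    have lower: "(e * prob W) * vol n \<le> prob (A n)" if n: "N2 \<le> n" for n
    proof -
      note n' = ge_N1[OF ge[OF n]]
      have "prob (B g (4 * rh n)) \<le> C ^ 2 * (b * q n)" if g: "g \<in> G n" for g
      proof -
        have "prob (B g (2 ^ 2 * rh n)) \<le> C ^ 2 * prob (B g (rh n))"
          using n' by (intro doubling_power) auto
        also have "\<dots> \<le> C ^ 2 * (b * q n)"
          using le_q[OF ge[OF n]] g G(2)[OF n] C_ge1 by (intro mult_left_mono) auto
        finally show ?thesis by simp
      qed
      then have "\<kappa> * prob W \<le> (\<Sum>g\<in>G n. C ^ 2 * (b * q n))"
        using G(5)[OF n] by (meson order_trans sum_mono)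
      then have "c1 / (b ^ 2 * C ^ 2) * (\<kappa> * prob W) \<le> c1 / (b ^ 2 * C ^ 2) * (\<Sum>g\<in>G n. C ^ 2 * (b * q n))"
        using c1_pos by (intro mult_left_mono) auto
      then have "e * prob W \<le> c1 / (b ^ 2 * C ^ 2) * (card (G n) * (C ^ 2 * (b * q n)))"
        by (simp add: e_def)
      also have "\<dots> = card (G n) * (c1 / b * q n)"
        using b_ge1 C_ge1 by (simp add: power2_eq_square)
      finally have "e * prob W * vol n \<le> card (G n) * (c1 / b * q n) * vol n"
        using vol_pos[of n] n' by (intro mult_right_mono) auto
      also have "\<dots> = (\<Sum>g\<in>G n. c1 / b * (q n * vol n))" by simp
      also have "\<dots> \<le> (\<Sum>g\<in>G n. prob (piece n g))"
        using G(2)[OF n] by (intro sum_mono piece_ge ge n) auto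
      also have "\<dots> = prob (A n)"
        unfolding A_def
      proof (rule finite_measure_finite_Union[symmetric])
        show "disjoint_family_on (piece n) (G n)"
          using half_balls_disjoint[of n "G n"] G(3)[OF n] n'
          unfolding disjoint_family_on_def piece_def by blast
      qed (use G(1)[OF n] piece_sets[OF ge[OF n]] in auto)
      finally show ?thesis .
    qed
    have diag: "prob (A n) \<le> L * vol n" if n: "N2 \<le> n" for n
    proof -
      have v: "0 < vol n" using vol_pos ge_N1[OF ge[OF n]] by auto
      have "prob (A n) \<le> (\<Sum>g\<in>G n. prob (piece n g))"
        unfolding A_def using G(1)[OF n] piece_sets[OF ge[OF n]]
        by (intro finite_measure_subadditive_finite) auto
      also have "\<dots> \<le> (\<Sum>g\<in>G n. c2 * b * (q n * vol n))"
        using G(2)[OF n] by (intro sum_mono piece_le ge n) auto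
      also have "\<dots> = (card (G n) * q n) * (c2 * b * vol n)" by simp
      also have "\<dots> \<le> (b * C * prob W) * (H * vol n)"
      proof (rule mult_mono)
        show "c2 * b * vol n \<le> H * vol n" using H_bounds(1) v by (intro mult_right_mono) auto
      qed (use card_le[OF n] v b_ge1 C_ge1 c2_ge1 in auto)
      finally show ?thesis by (simp add: L_def mult_ac)
    qed
    have cross: "prob (A s \<inter> A t) \<le> L * (vol s * vol t + overlap s t)"
      if s: "N2 \<le> s" and t: "N2 \<le> t" for s t
    proof -
      note ns = ge_N1[OF ge[OF s]] and nt = ge_N1[OF ge[OF t]]
      have "A s \<inter> A t = (\<Union>c\<in>G s. piece s c \<inter> A t)" by (auto simp: A_def)
      also have "prob \<dots> \<le> (\<Sum>c\<in>G s. prob (piece s c \<inter> A t))"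
        using G(1)[OF s] piece_sets[OF ge[OF s]] A_sets[OF t]
        by (intro finite_measure_subadditive_finite) auto
      also have "\<dots> \<le> (\<Sum>c\<in>G s. H * (q s * (vol s * vol t + overlap s t)))"
        unfolding A_def
        using G(2)[OF s] G(1-3)[OF t] ge[OF s] ge[OF t] by (intro sum_mono cross_le) auto
      also have "\<dots> = (card (G s) * q s) * (H * (vol s * vol t + overlap s t))" by simp
      also have "\<dots> \<le> (b * C * prob W) * (H * (vol s * vol t + overlap s t))"
        using card_le[OF s] H_bounds(3) vol_pos[of s] vol_pos[of t] overlap_nonneg[of s t] ns nt
        by (intro mult_right_mono) auto
      finally show ?thesis by (simp add: L_def mult_ac)
    qed
    have "c * prob W \<le> prob (W \<inter> (\<Union>n\<in>{N..}. level n))" if N: "N \<ge> N2" for N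
    proof -
      have N1': "1 \<le> N" using N N0 by (simp add: N2_def)
      define S where "S Q = (\<Sum>n=1..Q. vol n)" for Q
      \<comment> \<open>The hypotheses sum from 1, the tail starts at \<open>N\<close>. Choosing
        \<open>Q\<close> with \<open>2 * T + 1 \<le> S Q\<close> leaves at least half of the sum in
        the tail.\<close>
      define T where "T = (\<Sum>n=1..<N. vol n)"
      have T0: "0 \<le> T" unfolding T_def using vol_pos by (intro sum_nonneg) (auto intro: less_imp_le)
      have "\<forall>\<^sub>F Q in sequentially. 2 * T + 1 \<le> S Q"
        using divergence unfolding filterlim_at_top S_def vol_def by blast
      then have "\<forall>\<^sub>F Q in sequentially. 2 * T + 1 \<le> S Q \<and> N \<le> Q \<and>
          (\<Sum>s\<in>{1..<Q}. rh s powr \<gamma> / q s *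
            (\<Sum>t\<in>{t. s + 1 \<le> t \<and> t \<le> Q \<and> ps s < rh t}. p t / ps t powr \<gamma>)) \<le> K * (S Q)\<^sup>2"
        using quasi_independence eventually_ge_at_top[of N]
        unfolding S_def vol_def by eventually_elim auto
      then obtain Q where Q: "2 * T + 1 \<le> S Q" "N \<le> Q"
          "(\<Sum>s\<in>{1..<Q}. rh s powr \<gamma> / q s *
            (\<Sum>t\<in>{t. s + 1 \<le> t \<and> t \<le> Q \<and> ps s < rh t}. p t / ps t powr \<gamma>)) \<le> K * (S Q)\<^sup>2"
        using eventually_happens'[OF sequentially_bot] by blast
      define S' where "S' = (\<Sum>n=N..Q. vol n)"
      have "{1..Q} = {1..<N} \<union> {N..Q}" using N1' Q(2) by auto
      then have SS': "S Q = T + S'"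
        unfolding S_def T_def S'_def by (simp only:) (rule sum.union_disjoint, auto)
      define U where "U = (\<Union>n\<in>{N..Q}. A n)"
      have "((e * prob W) * S')\<^sup>2 \<le> prob U *
          (L * (S' + 2 * (\<Sum>s=N..Q. \<Sum>t=N..Q. if s < t then vol s * vol t + overlap s t else 0)))"
        unfolding U_def S'_def using N N1' A_sets lower diag cross e
        by (intro chung_erdos_weighted) (auto intro!: less_imp_le[OF vol_pos])
      \<comment> \<open>The restriction \<open>s < t\<close> is dropped from the product terms,
        whose full double sum is \<open>S'\<^sup>2\<close>, and kept for the overlaps.\<close>
      also have "(\<Sum>s=N..Q. \<Sum>t=N..Q. if s < t then vol s * vol t + overlap s t else 0)
          \<le> S'\<^sup>2 + K * (S Q)\<^sup>2"
      proof -
        have "(\<Sum>s=N..Q. \<Sum>t=N..Q. if s < t then vol s * vol t + overlap s t else 0)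
          \<le> (\<Sum>s=N..Q. \<Sum>t=N..Q. vol s * vol t + (if s < t then overlap s t else 0))"
          using N1' vol_pos by (intro sum_mono) (auto intro!: mult_nonneg_nonneg less_imp_le)
        also have "\<dots> = S'\<^sup>2 + (\<Sum>s=N..Q. \<Sum>t=N..Q. if s < t then overlap s t else 0)"
          by (simp add: sum.distrib S'_def power2_eq_square sum_product)
        finally show ?thesis using sum_overlap_le[OF N1', of Q] Q(3) by linarith
      qed
      \<comment> \<open>Since \<open>1 \<le> S Q\<close>, the linear diagonal term is absorbed by
        the square.\<close>
      also have "S' + 2 * (S'\<^sup>2 + K * (S Q)\<^sup>2) \<le> (3 + 2 * K) * (S Q)\<^sup>2"
      proof -
        have "S' \<le> S Q" "0 \<le> S'" "1 \<le> S Q" using SS' T0 Q(1) by auto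
        then have "S'\<^sup>2 \<le> (S Q)\<^sup>2" "S' \<le> (S Q)\<^sup>2"
          using mult_mono[of 1 "S Q" "S'" "S Q"] power_mono[of "S'" "S Q" 2]
          by (auto simp: power2_eq_square)
        then show ?thesis by (simp add: algebra_simps)
      qed
      finally have main: "(e * prob W * S')\<^sup>2 \<le> prob U * (L * ((3 + 2 * K) * (S Q)\<^sup>2))"
        using H_bounds(3) b_ge1 C_ge1 by (simp add: L_def mult_left_mono)
      have SQ: "0 < S Q" "S Q / 2 \<le> S'" using SS' T0 Q(1) by auto
      have "(e * prob W * (S Q / 2))\<^sup>2 \<le> (e * prob W * S')\<^sup>2"
        using SQ e by (intro power_mono mult_left_mono) auto
      with main have "(e * prob W / 2)\<^sup>2 * (S Q)\<^sup>2 \<le> prob U * (L * (3 + 2 * K)) * (S Q)\<^sup>2"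
        by (simp add: power_mult_distrib power_divide mult_ac)
      then have fin: "(e * prob W / 2)\<^sup>2 \<le> prob U * (L * (3 + 2 * K))"
        using SQ(1) by (simp add: mult_le_cancel_right)
      have "c * prob W \<le> prob U"
      proof (cases "prob W = 0")
        case False
        then have "0 < prob W" by (simp add: zero_less_measure_iff)
        moreover have "prob W * (e\<^sup>2 * prob W) \<le> prob W * (prob U * (4 * (H * b * C * (3 + 2 * K))))"
          using fin by (simp add: L_def power2_eq_square algebra_simps)
        ultimately have "e\<^sup>2 * prob W \<le> prob U * (4 * (H * b * C * (3 + 2 * K)))"
          by (rule mult_left_le_imp_le[rotated])
        then show ?thesis using den by (simp add: c_def divide_le_eq pos_divide_le_eq)
      qed simp
      also have "\<dots> \<le> prob (W \<inter> (\<Union>n\<in>{N..}. level n))"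
      proof (rule finite_measure_mono)
        show "U \<subseteq> W \<inter> (\<Union>n\<in>{N..}. level n)"
        proof (unfold U_def, rule UN_least)
          fix n assume "n \<in> {N..Q}"
          then show "A n \<subseteq> W \<inter> (\<Union>n\<in>{N..}. level n)" using A_sub[of n] N by auto
        qed
      qed (use W level_sets in auto)
      finally show ?thesis .
    qed
    then show "\<exists>N0. \<forall>N\<ge>N0. c * prob W \<le> prob (W \<inter> (\<Union>n\<in>{N..}. level n))" by blast
  qed
  with c show ?thesis by blast
qed

end

subsection \<open>Resonant sets\<close>

text \<open>As only finitely many \<alpha> have \<beta> below a given bound, a point lies in
  infinitely many thickenings iff it lies in some with arbitrarily large \<beta>. This is a
  countable intersection of countable unions.\<close>

lemma limsup_set_sets:
  assumes J: "countable J" "\<And>C. finite {\<alpha>\<in>J. \<beta> \<alpha> \<le> C}"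
    and T: "\<And>\<alpha>. thickening (R \<alpha>) (\<psi> (\<beta> \<alpha>)) \<in> sets M"
  shows "limsup_set J R \<beta> \<psi> \<in> sets M"
proof -
  define T where "T \<alpha> = thickening (R \<alpha>) (\<psi> (\<beta> \<alpha>))" for \<alpha>
  have "limsup_set J R \<beta> \<psi> = (\<Inter>k::nat. \<Union>\<alpha>\<in>{\<alpha>\<in>J. real k < \<beta> \<alpha>}. T \<alpha>)"
  proof (intro set_eqI iffI)
    fix x assume x: "x \<in> limsup_set J R \<beta> \<psi>"
    have "\<exists>\<alpha>\<in>J. real k < \<beta> \<alpha> \<and> x \<in> T \<alpha>" for k :: nat
    proof (rule ccontr)
      assume "\<not> ?thesis"
      then have "{\<alpha>\<in>J. x \<in> T \<alpha>} \<subseteq> {\<alpha>\<in>J. \<beta> \<alpha> \<le> real k}" by (auto simp: not_less)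
      then show False
        using x J(2) finite_subset unfolding limsup_set_def T_def by blast
    qed
    then show "x \<in> (\<Inter>k::nat. \<Union>\<alpha>\<in>{\<alpha>\<in>J. real k < \<beta> \<alpha>}. T \<alpha>)" by auto
  next
    fix x assume x: "x \<in> (\<Inter>k::nat. \<Union>\<alpha>\<in>{\<alpha>\<in>J. real k < \<beta> \<alpha>}. T \<alpha>)"
    have "infinite {\<alpha>\<in>J. x \<in> T \<alpha>}"
    proof
      assume "finite {\<alpha>\<in>J. x \<in> T \<alpha>}"
      then have "bdd_above (\<beta> ` {\<alpha>\<in>J. x \<in> T \<alpha>})" by simp
      then obtain z where z: "\<And>\<alpha>. \<alpha> \<in> J \<Longrightarrow> x \<in> T \<alpha> \<Longrightarrow> \<beta> \<alpha> \<le> z"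
        by (auto simp: bdd_above_def)
      obtain k :: nat where "z < real k" using reals_Archimedean2 by blast
      moreover obtain \<alpha> where "\<alpha> \<in> J" "real k < \<beta> \<alpha>" "x \<in> T \<alpha>" using x by blast
      ultimately show False using z by fastforce
    qed
    then show "x \<in> limsup_set J R \<beta> \<psi>" by (simp add: limsup_set_def T_def)
  qed
  moreover have "(\<Union>\<alpha>\<in>{\<alpha>\<in>J. real k < \<beta> \<alpha>}. T \<alpha>) \<in> sets M" for k :: nat
    using J(1) T by (intro sets.countable_UN'') (auto simp: T_def intro: countable_subset[of _ J])
  ultimately show ?thesis by auto
qed

lemma intersection_conditionsE:
  assumes "intersection_conditions B m J R \<beta> u \<rho> \<gamma>"
  obtains c1 c2 Ni where "0 < c1" "1 < c2" "0 \<le> \<gamma>"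
      "\<And>n \<alpha> c t. Ni \<le> n \<Longrightarrow> \<alpha> \<in> J \<Longrightarrow> c \<in> R \<alpha> \<Longrightarrow> \<beta> \<alpha> \<le> u n \<Longrightarrow> 0 < t \<Longrightarrow> t \<le> \<rho> (u n) \<Longrightarrow>
           c1 * measure m (B c t) * (\<rho> (u n) / t) powr \<gamma>
             \<le> measure m (B c (\<rho> (u n) / 2) \<inter> thickening (R \<alpha>) t)"
      "\<And>n \<alpha> c t \<alpha>' x r. Ni \<le> n \<Longrightarrow> \<alpha> \<in> J \<Longrightarrow> c \<in> R \<alpha> \<Longrightarrow> \<beta> \<alpha> \<le> u n \<Longrightarrow> 0 < t \<Longrightarrow> t \<le> \<rho> (u n) \<Longrightarrow>
           \<alpha>' \<in> J \<Longrightarrow> x \<in> R \<alpha>' \<Longrightarrow> 0 < r \<Longrightarrow> r \<le> 3 * \<rho> (u n) \<Longrightarrow>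
              measure m (B x r \<inter> B c (3 * \<rho> (u n)) \<inter> thickening (R \<alpha>) (3 * t))
                \<le> c2 * measure m (B c t) * (r / t) powr \<gamma>"
proof -
  obtain c1 c2 Ni where c: "0 < c1" "1 < c2" and Ni: "\<forall>n\<ge>Ni. \<forall>\<alpha>\<in>J. \<forall>c\<in>R \<alpha>. \<forall>t. \<beta> \<alpha> \<le> u n \<and> 0 < t \<and> t \<le> \<rho> (u n) \<longrightarrow>
           c1 * measure m (B c t) * (\<rho> (u n) / t) powr \<gamma>
             \<le> measure m (B c (\<rho> (u n) / 2) \<inter> thickening (R \<alpha>) t) \<and>
           (\<forall>\<alpha>'\<in>J. \<forall>x\<in>R \<alpha>'. \<forall>r. 0 < r \<and> r \<le> 3 * \<rho> (u n) \<longrightarrow>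
              measure m (B x r \<inter> B c (3 * \<rho> (u n)) \<inter> thickening (R \<alpha>) (3 * t))
                \<le> c2 * measure m (B c t) * (r / t) powr \<gamma>)"
    using assms unfolding intersection_conditions_def by (elim conjE exE) (rule that)
  have "0 \<le> \<gamma>" using assms unfolding intersection_conditions_def by (elim conjE)
  show thesis
    by (rule that[OF c \<open>0 \<le> \<gamma>\<close>, of Ni]) (use Ni in \<open>simp_all\<close>)
qed

theorem theorem1:
  fixes m :: "'a::metric_space measure"
    and B :: "'a \<Rightarrow> real \<Rightarrow> 'a set"
    and J :: "'i set"
    and R :: "'i \<Rightarrow> 'a set"
    and \<beta> :: "'i \<Rightarrow> real"
    and l u :: "nat \<Rightarrow> real"
    and \<rho> \<psi> :: "real \<Rightarrow> real"
    and \<gamma> :: real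
    and Bn :: "nat \<Rightarrow> real \<Rightarrow> 'a set"
  assumes "compact (UNIV :: 'a set)"
    and "B = ball \<or> B = cball"
    and "prob_space m" and "space m = UNIV" and "non_atomic m"
    and "\<And>x r. 0 < r \<Longrightarrow> B x r \<in> sets m"
    and "\<And>x r. 0 < r \<Longrightarrow> 0 < measure m (B x r)"
    and "doubling_measure B m"
    and "countable J" and "infinite J"
    and "\<And>\<alpha>. \<alpha> \<in> J \<Longrightarrow> 0 < \<beta> \<alpha>"
    and "\<And>C. finite {\<alpha>\<in>J. \<beta> \<alpha> \<le> C}"
    and "lower_upper_sequences l u"
    and "condition_M1 B m J R \<beta> l u"
    and "generic_balls B J R \<beta> l u Bn"
    and "ubiquity_function \<rho>"
    and "global_ubiquitous B m J R \<beta> l u \<rho> \<gamma>"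
    and "approximating_function \<psi>"
    and "limsup (\<lambda>n. ereal (\<psi> (u n) / \<rho> (u n))) > 0 \<or>
         (filterlim
            (\<lambda>Q. \<Sum>n=1..Q. measure m (Bn n (\<psi> (u n))) / measure m (Bn n (\<rho> (u n)))
                            * (\<rho> (u n) / \<psi> (u n)) powr \<gamma>)
            at_top sequentially \<and>
          (\<exists>K>0. \<forall>\<^sub>F Q in sequentially.
             (\<Sum>s\<in>{1..<Q}. (\<rho> (u s)) powr \<gamma> / measure m (Bn s (\<rho> (u s)))
                * (\<Sum>t\<in>{t. s + 1 \<le> t \<and> t \<le> Q \<and> \<psi> (u s) < \<rho> (u t)}.
                     measure m (Bn t (\<psi> (u t))) / (\<psi> (u t)) powr \<gamma>))
             \<le> K * (\<Sum>n=1..Q. measure m (Bn n (\<psi> (u n))) / measure m (Bn n (\<rho> (u n)))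
                               * (\<rho> (u n) / \<psi> (u n)) powr \<gamma>)\<^sup>2))"
  shows "0 < measure m (limsup_set J R \<beta> \<psi>) \<and>
         ((\<forall>U. open U \<longrightarrow> U \<in> sets m) \<and> local_ubiquitous B m J R \<beta> l u \<rho> \<gamma>
            \<longrightarrow> measure m (limsup_set J R \<beta> \<psi>) = 1)"
proof -

  \<comment> \<open>Instantiation for the given resonant sets\<close>
  obtain C where C: "1 \<le> C" "\<And>x r. 0 < r \<Longrightarrow> measure m (B x (2 * r)) \<le> C * measure m (B x r)"
    using \<open>doubling_measure B m\<close> unfolding doubling_measure_def by blast
  interpret doubling_balls m B C
    by (intro doubling_balls.intro doubling_balls_axioms.intro) (use assms C in auto)
  have lu: "0 < l n" "l n < u n" if "1 \<le> n" for n
    using \<open>lower_upper_sequences l u\<close> that unfolding lower_upper_sequences_def by auto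
  have l_lim: "filterlim l at_top sequentially"
    using \<open>lower_upper_sequences l u\<close> unfolding lower_upper_sequences_def by simp
  have u_pos: "0 < u n" if "1 \<le> n" for n using lu[OF that] by simp
  have "\<forall>\<^sub>F n in sequentially. l n \<le> u n"
    using eventually_ge_at_top[of 1] by eventually_elim (use lu in \<open>auto intro: less_imp_le\<close>)
  with l_lim have u_lim: "filterlim u at_top sequentially" by (rule filterlim_at_top_mono)
  have \<rho>: "\<And>r. 0 < r \<Longrightarrow> 0 < \<rho> r" "(\<rho> \<longlongrightarrow> 0) at_top"
    using \<open>ubiquity_function \<rho>\<close> unfolding ubiquity_function_def by auto
  have \<psi>: "\<And>r. 0 < r \<Longrightarrow> 0 < \<psi> r" "antimono_on {0<..} \<psi>"
    using \<open>approximating_function \<psi>\<close> unfolding approximating_function_def by auto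
  define X where "X n = (\<Union>\<alpha>\<in>index_block J \<beta> l u n. R \<alpha>)" for n
  \<comment> \<open>A resonant point may lie on several resonant sets of its block; one is chosen,
    so that nets of points can index the pieces.\<close>
  define ix where "ix n c = (SOME \<alpha>. \<alpha> \<in> index_block J \<beta> l u n \<and> c \<in> R \<alpha>)" for n c
  have ix: "ix n c \<in> index_block J \<beta> l u n" "c \<in> R (ix n c)" if "c \<in> X n" for n c
    using someI_ex[of "\<lambda>\<alpha>. \<alpha> \<in> index_block J \<beta> l u n \<and> c \<in> R \<alpha>"] that
    unfolding X_def ix_def by auto
  have ixJ: "ix n c \<in> J" "l n < \<beta> (ix n c)" "\<beta> (ix n c) \<le> u n" if "c \<in> X n" for n c
    using ix[OF that] unfolding index_block_def by auto
  interpret resonant_blocks m B C X "\<lambda>n c. R (ix n c)" "\<lambda>n. \<rho> (u n)" "\<lambda>n. \<psi> (u n)"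
  proof unfold_locales
    show "R (ix n c) \<subseteq> X n" if "c \<in> X n" for n c using ix[OF that] by (auto simp: X_def)
    show "(\<lambda>n. \<rho> (u n)) \<longlonglongrightarrow> 0" using \<rho>(2) u_lim by (rule filterlim_compose)
  qed (use ix u_pos \<rho> \<psi> in auto)
  have block: "thickened_block J R \<beta> l u \<rho> n = thickening (X n) (\<rho> (u n))" for n
    unfolding thickened_block_def X_def set_eq_iff UN_iff thickening_iff by blast
  have \<Lambda>_sets: "limsup_set J R \<beta> \<psi> \<in> sets m"
    using assms open_sets[OF open_thickening] by (intro limsup_set_sets) auto
  \<comment> \<open>If only finitely many indices counted for \<open>x\<close>, some
    \<open>z\<close> would bound \<beta> on them. A level containing \<open>x\<close> with
    \<open>l n > z\<close> gives a further index, because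
    \<open>\<psi> (u n) \<le> \<psi> (\<beta> \<alpha>)\<close> for \<alpha> in that block.\<close>
  have sub: "limsup_level \<subseteq> limsup_set J R \<beta> \<psi>"
  proof
    fix x assume x: "x \<in> limsup_level"
    have "infinite {\<alpha>\<in>J. x \<in> thickening (R \<alpha>) (\<psi> (\<beta> \<alpha>))}" (is "infinite ?F")
    proof
      assume "finite ?F"
      then have "bdd_above (\<beta> ` ?F)" by simp
      then obtain z where z: "\<And>\<alpha>. \<alpha> \<in> ?F \<Longrightarrow> \<beta> \<alpha> \<le> z"
        by (auto simp: bdd_above_def)
      have "\<forall>\<^sub>F n in sequentially. z < l n \<and> 1 \<le> n"
        using l_lim eventually_ge_at_top[of 1] by (auto simp: filterlim_at_top_dense intro: eventually_conj)
      then obtain N where N: "\<And>n. N \<le> n \<Longrightarrow> z < l n \<and> 1 \<le> n"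
        by (auto simp: eventually_sequentially)
      obtain n where n: "N \<le> n" "x \<in> level n"
        using x by (auto simp: limsup_level_def)
      obtain c where c: "c \<in> X n" "x \<in> thickening (R (ix n c)) (\<psi> (u n))"
        using n(2) by (auto simp: level_def)
      have "\<psi> (u n) \<le> \<psi> (\<beta> (ix n c))"
        using \<psi>(2) ixJ[OF c(1)] assms(11) u_pos[of n] N[OF n(1)] by (auto intro: monotone_onD)
      then have "x \<in> thickening (R (ix n c)) (\<psi> (\<beta> (ix n c)))"
        using c(2) by (force simp: thickening_iff)
      then have "\<beta> (ix n c) \<le> z" using ixJ[OF c(1)] by (intro z) auto
      then show False using ixJ[OF c(1)] N[OF n(1)] by simp
    qed
    then show "x \<in> limsup_set J R \<beta> \<psi>" by (simp add: limsup_set_def)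
  qed
  obtain \<kappa> n0 where glob: "0 < \<kappa>" "1 \<le> n0"
      "\<And>n. n0 \<le> n \<Longrightarrow> \<kappa> \<le> prob (thickening (X n) (\<rho> (u n)))"
    using \<open>global_ubiquitous B m J R \<beta> l u \<rho> \<gamma>\<close> unfolding global_ubiquitous_def block by metis
  have X_ne: "X n \<noteq> {}" if "n0 \<le> n" for n
    using glob(1) glob(3)[OF that] by (auto simp: thickening_def)
  \<comment> \<open>The split is on whether \<psi> is comparable to \<rho> along infinitely many
    \<open>u n\<close>. If not, the limsup is not positive, so the series hypotheses hold, and
    \<open>\<psi> (u n) < \<rho> (u n)\<close> eventually, as the intersection conditions require of
    the radius.\<close>
  have dens: "\<exists>c>0. density_bound \<kappa> c" if \<kappa>: "0 < \<kappa>" for \<kappa>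
  proof (cases "\<exists>\<eta>>0. \<exists>\<^sub>F n in sequentially. \<eta> * \<rho> (u n) \<le> \<psi> (u n)")
    case True
    then show ?thesis using density_bound_of_frequently \<kappa> by blast
  next
    case False
    then have small: "\<forall>\<^sub>F n in sequentially. \<psi> (u n) < \<eta> * \<rho> (u n)" if "0 < \<eta>" for \<eta>
      using that by (auto simp: not_frequently not_le)
    have "\<not> 0 < limsup (\<lambda>n. ereal (\<psi> (u n) / \<rho> (u n)))"
    proof
      assume "0 < limsup (\<lambda>n. ereal (\<psi> (u n) / \<rho> (u n)))"
      then obtain \<eta> where \<eta>: "0 < ereal \<eta>" "ereal \<eta> < limsup (\<lambda>n. ereal (\<psi> (u n) / \<rho> (u n)))"
        using ereal_dense2 by blast
      then have "0 < \<eta>" by simp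
      have "\<forall>\<^sub>F n in sequentially. ereal (\<psi> (u n) / \<rho> (u n)) \<le> ereal \<eta>"
        using small[OF \<open>0 < \<eta>\<close>] eventually_ge_at_top[of 1]
        by eventually_elim (use \<rho>(1) u_pos in \<open>simp add: divide_le_eq\<close>)
      then have "limsup (\<lambda>n. ereal (\<psi> (u n) / \<rho> (u n))) \<le> ereal \<eta>" by (rule Limsup_bounded)
      with \<eta> show False by simp
    qed
    then obtain K where div: "filterlim
            (\<lambda>Q. \<Sum>n=1..Q. measure m (Bn n (\<psi> (u n))) / measure m (Bn n (\<rho> (u n)))
                            * (\<rho> (u n) / \<psi> (u n)) powr \<gamma>) at_top sequentially"
      and K: "0 < K" "\<forall>\<^sub>F Q in sequentially.
             (\<Sum>s\<in>{1..<Q}. (\<rho> (u s)) powr \<gamma> / measure m (Bn s (\<rho> (u s)))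
                * (\<Sum>t\<in>{t. s + 1 \<le> t \<and> t \<le> Q \<and> \<psi> (u s) < \<rho> (u t)}.
                     measure m (Bn t (\<psi> (u t))) / (\<psi> (u t)) powr \<gamma>))
             \<le> K * (\<Sum>n=1..Q. measure m (Bn n (\<psi> (u n))) / measure m (Bn n (\<rho> (u n)))
                               * (\<rho> (u n) / \<psi> (u n)) powr \<gamma>)\<^sup>2"
      using assms(19) by blast
    obtain r0 a b where M1: "0 < r0" "0 < b"
      "\<And>n \<alpha> \<alpha>' c c' r. 1 \<le> n \<Longrightarrow> \<alpha> \<in> index_block J \<beta> l u n \<Longrightarrow> \<alpha>' \<in> index_block J \<beta> l u n \<Longrightarrow>
         c \<in> R \<alpha> \<Longrightarrow> c' \<in> R \<alpha>' \<Longrightarrow> 0 < r \<Longrightarrow> r < r0 \<Longrightarrow> prob (B c r) / prob (B c' r) \<le> b"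
      using \<open>condition_M1 B m J R \<beta> l u\<close> unfolding condition_M1_def by metis
    obtain c1 c2 Ni where ic: "0 < c1" "1 < c2" "0 \<le> \<gamma>"
      "\<And>n \<alpha> c t. Ni \<le> n \<Longrightarrow> \<alpha> \<in> J \<Longrightarrow> c \<in> R \<alpha> \<Longrightarrow> \<beta> \<alpha> \<le> u n \<Longrightarrow> 0 < t \<Longrightarrow> t \<le> \<rho> (u n) \<Longrightarrow>
           c1 * prob (B c t) * (\<rho> (u n) / t) powr \<gamma>
             \<le> prob (B c (\<rho> (u n) / 2) \<inter> thickening (R \<alpha>) t)"
      "\<And>n \<alpha> c t \<alpha>' x r. Ni \<le> n \<Longrightarrow> \<alpha> \<in> J \<Longrightarrow> c \<in> R \<alpha> \<Longrightarrow> \<beta> \<alpha> \<le> u n \<Longrightarrow> 0 < t \<Longrightarrow> t \<le> \<rho> (u n) \<Longrightarrow>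
           \<alpha>' \<in> J \<Longrightarrow> x \<in> R \<alpha>' \<Longrightarrow> 0 < r \<Longrightarrow> r \<le> 3 * \<rho> (u n) \<Longrightarrow>
              prob (B x r \<inter> B c (3 * \<rho> (u n)) \<inter> thickening (R \<alpha>) (3 * t))
                \<le> c2 * prob (B c t) * (r / t) powr \<gamma>"
      using \<open>global_ubiquitous B m J R \<beta> l u \<rho> \<gamma>\<close>
      unfolding global_ubiquitous_def by (elim conjE intersection_conditionsE) (rule that)
    have "\<forall>\<^sub>F n in sequentially. \<rho> (u n) < r0" using rh_lim M1(1) by (rule order_tendstoD(2))
    with small[of 1] have "\<forall>\<^sub>F n in sequentially. \<rho> (u n) < r0 \<and> \<psi> (u n) < \<rho> (u n)"
      by (auto intro: eventually_conj)
    then obtain N where N: "\<And>n. N \<le> n \<Longrightarrow> \<rho> (u n) < r0 \<and> \<psi> (u n) < \<rho> (u n)"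
      by (auto simp: eventually_sequentially)
    \<comment> \<open>Beyond \<open>N1\<close> the intersection conditions hold and
      \<open>\<psi> (u n) < \<rho> (u n) < r0\<close>, so condition (M1) covers both radii.\<close>
    define N1 where "N1 = Max {1, n0, Ni, N}"
    have N1: "1 \<le> n" "n0 \<le> n" "Ni \<le> n" "\<rho> (u n) < r0" "\<psi> (u n) < \<rho> (u n)" if "N1 \<le> n" for n
      using that N[of n] by (auto simp: N1_def)
    \<comment> \<open>The maximum normalizes the comparison constant to be at least 1, as
      \<open>weighted_blocks\<close> demands.\<close>
    have compare: "prob (B c r) \<le> max 1 b * prob (B c' r)"
      if "1 \<le> n" "c \<in> X n" "c' \<in> X n" "0 < r" "r < r0" for n c c' r
    proof -
      have "prob (B c r) / prob (B c' r) \<le> b"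
        using M1(3)[OF that(1)] ix that by blast
      then have "prob (B c r) \<le> b * prob (B c' r)"
        using B_pos[of r c'] that by (simp add: divide_le_eq)
      also have "\<dots> \<le> max 1 b * prob (B c' r)" by (intro mult_right_mono) auto
      finally show ?thesis .
    qed
    have Bn: "\<exists>c. Bn n r = B c r \<and> (X n \<noteq> {} \<longrightarrow> c \<in> X n)" if "1 \<le> n" "0 < r" for n r
      using \<open>generic_balls B J R \<beta> l u Bn\<close> that unfolding generic_balls_def X_def by blast
    have Bn_pos: "0 < prob (Bn n r)" if "1 \<le> n" "0 < r" for n r
      using Bn[OF that] B_pos[OF that(2)] by auto
    have Bn_compare: "prob (Bn n r) \<le> max 1 b * prob (B c r)" "prob (B c r) \<le> max 1 b * prob (Bn n r)"
      if "N1 \<le> n" "c \<in> X n" "0 < r" "r < r0" for n c r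
      using Bn[of n r] N1[OF that(1)] compare[of n _ _ r] that by auto
    have pos: "0 < \<rho> (u n)" "0 < \<psi> (u n)" if "1 \<le> n" for n
      using u_pos[OF that] \<rho>(1) \<psi>(1) by auto
    interpret weighted_blocks m B C X "\<lambda>n c. R (ix n c)" "\<lambda>n. \<rho> (u n)" "\<lambda>n. \<psi> (u n)"
      "\<lambda>n. prob (Bn n (\<psi> (u n)))" "\<lambda>n. prob (Bn n (\<rho> (u n)))" "max 1 b" c1 c2 \<gamma> K N1
    proof unfold_locales
      show "prob (B c r) \<le> max 1 b * prob (B c' r)"
        if "N1 \<le> n" "c \<in> X n" "c' \<in> X n" "0 < r" "r \<le> \<rho> (u n)" for n c c' r
        using compare[of n c c' r] N1[of n] that by auto
      show "c1 * prob (B c (\<psi> (u n))) * (\<rho> (u n) / \<psi> (u n)) powr \<gamma>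
        \<le> prob (B c (\<rho> (u n) / 2) \<inter> thickening (R (ix n c)) (\<psi> (u n)))"
        if "N1 \<le> n" "c \<in> X n" for n c
        using ic(4)[of n "ix n c" c "\<psi> (u n)"] N1[of n] pos[of n] ix[of c n] ixJ[of c n] that by auto
      show "prob (B x r \<inter> B c (3 * \<rho> (u n)) \<inter> thickening (R (ix n c)) (3 * t))
          \<le> c2 * prob (B c t) * (r / t) powr \<gamma>"
        if "N1 \<le> n" "c \<in> X n" "0 < t" "t \<le> \<rho> (u n)" "x \<in> X k" "0 < r" "r \<le> 3 * \<rho> (u n)" for n c t k x r
        using ic(5)[of n "ix n c" c t "ix k x" x r] N1[of n] ix ixJ that by auto
      show "1 \<le> N1" by (simp add: N1_def)
      show "\<psi> (u n) \<le> \<rho> (u n)" if "N1 \<le> n" for n using N1[OF that] by simp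
      show "prob (Bn n (\<psi> (u n))) \<le> max 1 b * prob (B c (\<psi> (u n)))"
           "prob (B c (\<psi> (u n))) \<le> max 1 b * prob (Bn n (\<psi> (u n)))"
           "prob (Bn n (\<rho> (u n))) \<le> max 1 b * prob (B c (\<rho> (u n)))"
           "prob (B c (\<rho> (u n))) \<le> max 1 b * prob (Bn n (\<rho> (u n)))"
        if "N1 \<le> n" "c \<in> X n" for n c
        using N1[OF that(1)] pos[of n] by (auto intro!: Bn_compare that)
      show "0 < prob (Bn n (\<psi> (u n)))" "0 < prob (Bn n (\<rho> (u n)))" if "1 \<le> n" for n
        using Bn_pos pos that by auto
    qed (use ic K div in auto)
    show ?thesis using \<kappa> by (rule density_bound_of_divergence)
  qed

  \<comment> \<open>Global and local conclusions\<close>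
  have "0 < prob (limsup_set J R \<beta> \<psi>)"
  proof -
    obtain c where "0 < c" "density_bound \<kappa> c" using dens glob(1) by blast
    moreover have "\<forall>\<^sub>F n in sequentially. \<kappa> \<le> prob (thickening (X n) (\<rho> (u n)))"
      using glob(3) by (auto simp: eventually_sequentially)
    ultimately have "0 < prob limsup_level" by (intro prob_limsup_level_pos) auto
    then show ?thesis using finite_measure_mono[OF sub \<Lambda>_sets] by simp
  qed
  moreover have "prob (limsup_set J R \<beta> \<psi>) = 1" if local: "local_ubiquitous B m J R \<beta> l u \<rho> \<gamma>"
  proof -
    obtain r0 \<kappa>' where "0 < r0" "0 < \<kappa>'" and loc: "\<And>x r. 0 < r \<Longrightarrow> r \<le> r0 \<Longrightarrow>
        \<exists>n0\<ge>1. \<forall>n\<ge>n0. \<kappa>' * prob (B x r) \<le> prob (B x r \<inter> thickening (X n) (\<rho> (u n)))"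
      using local unfolding local_ubiquitous_def block by metis
    have "prob limsup_level = 1"
    proof (rule prob_limsup_level_eq_1[OF dens \<open>0 < r0\<close> \<open>0 < \<kappa>'\<close>])
      show "\<forall>\<^sub>F n in sequentially. \<kappa>' * prob (B x r) \<le> prob (B x r \<inter> thickening (X n) (\<rho> (u n)))"
        if "0 < r" "r \<le> r0" for x r
        using loc[OF that] by (auto simp: eventually_sequentially)
    qed
    then show ?thesis
      using finite_measure_mono[OF sub \<Lambda>_sets] prob_le_1 by (simp add: antisym)
  qed
  ultimately show ?thesis by blast
qed

end
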